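(* Let $X$ be a non-separable reflexive (real or complex) Banach space. Then for every infinite-dimensional separable closed subspace $Y\subset X$ and for every real number $\lambda\in(1,\infty)$ there exists a J-class operator $T\in L(X)$ with $Y\subset A_T$ and $\|T\|=\lambda$.
   Context: For a Banach space $X$, $L(X)$ denotes the space of bounded linear operators $X\to X$. For $T\in L(X)$ and $x\in X$, the J-set of $x$ under $T$ is $$J_T(x):=\{y\in X:\ \text{there exist a strictly increasing sequence of natural numbers } (k_n) \text{ and a sequence } (x_n) \text{ in } X \text{ such that } x_n\to x \text{ and } T^{k_n}x_n\to y\},$$ with convergence in norm. $T$ is called a J-class operator if $J_T(x)=X$ for some $x\in X\setminus\{0\}$. The set $A_T$ is $A_T:=\{x\in X: J_T(x)=X\}$. *)

theory Defs
  imports "HOL-Analysis.Analysis"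
begin

text \<open>
  The library has no type class of complex normed spaces. A normed space over
  \<open>'k\<close> (used with \<open>real\<close> and \<open>complex\<close>) is a type of class
  \<open>real_normed_vector\<close> with a scalar multiplication by \<open>'k\<close> that extends the real one.
  No generality is lost: every complex Banach space is a real Banach space with the same
  norm by restriction of scalars. Over \<open>real\<close> the only such scalar multiplication is
  \<open>scaleR\<close>.
\<close>

locale normed_space_over = vector_space sc
  for sc :: "'k::real_normed_field \<Rightarrow> 'a::real_normed_vector \<Rightarrow> 'a" +
  assumes scale_of_real: "sc (of_real r) x = r *\<^sub>R x"
    and norm_scale: "norm (sc c x) = norm c * norm x"

lemma normed_space_over_scaleR:
  "normed_space_over (scaleR :: real \<Rightarrow> 'a::real_normed_vector \<Rightarrow> 'a)"
  by unfold_locales (auto simp: algebra_simps)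

lemma normed_space_over_complex: "normed_space_over ((*) :: complex \<Rightarrow> complex \<Rightarrow> complex)"
  by unfold_locales (auto simp: algebra_simps scaleR_conv_of_real norm_mult)

definition bounded_linear_over ::
    "('k \<Rightarrow> 'a::real_normed_vector \<Rightarrow> 'a) \<Rightarrow> ('k \<Rightarrow> 'b::real_normed_vector \<Rightarrow> 'b)
      \<Rightarrow> ('a \<Rightarrow> 'b) \<Rightarrow> bool"
  where "bounded_linear_over s1 s2 f \<longleftrightarrow>
    bounded_linear f \<and> (\<forall>c x. f (s1 c x) = s2 c (f x))"

lemma bounded_linear_over_scaleR:
  "bounded_linear_over scaleR scaleR f \<longleftrightarrow> bounded_linear f"
  by (auto simp: bounded_linear_over_def linear_simps)

definition dual_space ::
    "('k::real_normed_field \<Rightarrow> 'a::real_normed_vector \<Rightarrow> 'a) \<Rightarrow> ('a \<Rightarrow> 'k) set"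
  where "dual_space sc = {f. bounded_linear_over sc (*) f}"

text \<open>
  Elements of the bidual are total functions on \<open>'a \<Rightarrow> 'k\<close>, of which only the values
  on the dual space, normed by \<open>onorm\<close>, matter.
\<close>

definition bidual_space ::
    "('k::real_normed_field \<Rightarrow> 'a::real_normed_vector \<Rightarrow> 'a) \<Rightarrow> (('a \<Rightarrow> 'k) \<Rightarrow> 'k) set"
  where "bidual_space sc = {\<Phi>.
    (\<forall>f\<in>dual_space sc. \<forall>g\<in>dual_space sc. \<Phi> (\<lambda>x. f x + g x) = \<Phi> f + \<Phi> g) \<and>
    (\<forall>c. \<forall>f\<in>dual_space sc. \<Phi> (\<lambda>x. c * f x) = c * \<Phi> f) \<and>
    (\<exists>K. \<forall>f\<in>dual_space sc. norm (\<Phi> f) \<le> K * onorm f)}"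

definition reflexive_space ::
    "('k::real_normed_field \<Rightarrow> 'a::real_normed_vector \<Rightarrow> 'a) \<Rightarrow> bool"
  where "reflexive_space sc \<longleftrightarrow>
    (\<forall>\<Phi>\<in>bidual_space sc. \<exists>x. \<forall>f\<in>dual_space sc. \<Phi> f = f x)"

definition J_set :: "('a::topological_space \<Rightarrow> 'a) \<Rightarrow> 'a \<Rightarrow> 'a set"
  where "J_set T x = {y. \<exists>(k :: nat \<Rightarrow> nat) (xs :: nat \<Rightarrow> 'a).
    strict_mono k \<and> xs \<longlonglongrightarrow> x \<and> (\<lambda>n. (T ^^ k n) (xs n)) \<longlonglongrightarrow> y}"

definition A_set :: "('a::topological_space \<Rightarrow> 'a) \<Rightarrow> 'a set"
  where "A_set T = {x. J_set T x = UNIV}"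

definition J_class :: "('a::real_normed_vector \<Rightarrow> 'a) \<Rightarrow> bool"
  where "J_class T \<longleftrightarrow> (\<exists>x. x \<noteq> 0 \<and> J_set T x = UNIV)"

end

theory Submission
  imports Defs
begin

text \<open>
  In a reflexive space every separable subspace lies in a separable closed subspace \<open>Z\<close> that is the
  range of a projection \<open>P\<close> of norm one. On \<open>Z\<close> one takes a perturbation \<open>I + K\<close> of the identity
  that acts on a fundamental biorthogonal sequence \<open>g\<close> as the exponential of the backward shift
  \<open>g n \<mapsto> g (n - 1)\<close>; rescaling \<open>g\<close> makes the norm of \<open>K\<close> as small as desired. The powers of the
  exponential are explicit, and Pade approximation of \<open>exp\<close> produces, for each \<open>k\<close>, vectors
  \<open>x\<^sub>n \<longlonglongrightarrow> 0\<close> with \<open>T\<^sup>n x\<^sub>n \<longlonglongrightarrow> g k\<close> and vectors \<open>x\<^sub>n \<longlonglongrightarrow> g k\<close> with \<open>T\<^sup>n x\<^sub>n \<longlonglongrightarrow> 0\<close>. On the kernel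
  of \<open>P\<close> the operator is the expansion \<open>(1 + \<mu>) I\<close>. The norm of \<open>T = I + K + \<mu> (I - P)\<close>
  depends continuously on \<open>\<mu>\<close>, is close to 1 for small \<open>\<mu>\<close> and unbounded, so it takes
  the value \<open>\<lambda>\<close>.
\<close>

subsection \<open>Hahn-Banach theorem\<close>

definition sublinear :: "('v::real_vector \<Rightarrow> real) \<Rightarrow> bool"
  where "sublinear q \<longleftrightarrow>
    (\<forall>x y. q (x + y) \<le> q x + q y) \<and> (\<forall>r\<ge>0. \<forall>x. q (r *\<^sub>R x) = r * q x)"

lemma sublinear_add: "sublinear q \<Longrightarrow> q (x + y) \<le> q x + q y"
  and sublinear_scale: "sublinear q \<Longrightarrow> 0 \<le> r \<Longrightarrow> q (r *\<^sub>R x) = r * q x"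
  by (auto simp: sublinear_def)

lemma sublinear_0: "sublinear q \<Longrightarrow> q 0 = 0"
  using sublinear_scale[of q 0 0] by simp

lemma sublinear_minus: "sublinear q \<Longrightarrow> - q (- x) \<le> q x"
  using sublinear_add[of q x "- x"] sublinear_0[of q] by simp

text \<open>The witness is the infimum over \<open>m\<close> in \<open>C\<close> of
  \<open>q (x + m) - h m\<close>. It is finite because subadditivity and \<open>h \<le> q\<close> on
  \<open>C\<close> bound it below by \<open>- q (- x)\<close>. Taking \<open>m = 0\<close> puts it
  below \<open>q\<close>, and taking \<open>m = a\<close> at the point \<open>- a\<close> gives the
  last conclusion. With a ray as \<open>C\<close> it shows that minimal functionals are linear; with
  a subspace it builds the prescribed values into the bound.\<close>

lemma sublinear_cone_inf:
  fixes q :: "'v::real_vector \<Rightarrow> real"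
  assumes q: "sublinear q"
    and C0: "0 \<in> C"
    and Cadd: "\<And>a b. a \<in> C \<Longrightarrow> b \<in> C \<Longrightarrow> a + b \<in> C"
    and Cscale: "\<And>r a. 0 \<le> r \<Longrightarrow> a \<in> C \<Longrightarrow> r *\<^sub>R a \<in> C"
    and hadd: "\<And>a b. a \<in> C \<Longrightarrow> b \<in> C \<Longrightarrow> h (a + b) = h a + h b"
    and hscale: "\<And>r a. 0 \<le> r \<Longrightarrow> a \<in> C \<Longrightarrow> h (r *\<^sub>R a) = r * h a"
    and hq: "\<And>a. a \<in> C \<Longrightarrow> h a \<le> q a"
  obtains q' where "sublinear q'" "q' \<le> q" "\<And>a. a \<in> C \<Longrightarrow> q' (- a) \<le> - h a"
proof -
  define q' where "q' x = (INF m\<in>C. q (x + m) - h m)" for x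
  have bdd: "bdd_below ((\<lambda>m. q (x + m) - h m) ` C)" for x
  proof (rule bdd_belowI2)
    fix m assume "m \<in> C"
    then show "- q (- x) \<le> q (x + m) - h m"
      using sublinear_add[OF q, of "- x" "x + m"] hq[of m] by simp
  qed
  have le: "q' x \<le> q (x + m) - h m" if "m \<in> C" for x m
    unfolding q'_def by (rule cINF_lower[OF bdd that])
  have ge: "c \<le> q' x" if "\<And>m. m \<in> C \<Longrightarrow> c \<le> q (x + m) - h m" for c x
    unfolding q'_def using C0 that by (intro cINF_greatest) auto
  have h0: "h 0 = 0" using hscale[of 0 0] C0 by simp
  have add: "q' (x + y) \<le> q' x + q' y" for x y
  proof -
    have "q' (x + y) - q' y \<le> q' x"
    proof (rule ge)
      fix m assume m: "m \<in> C"
      have "q' (x + y) - (q (x + m) - h m) \<le> q' y"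
      proof (rule ge)
        fix n assume n: "n \<in> C"
        show "q' (x + y) - (q (x + m) - h m) \<le> q (y + n) - h n"
          using le[OF Cadd[OF m n], of "x + y"] hadd[OF m n]
            sublinear_add[OF q, of "x + m" "y + n"] by (simp add: algebra_simps)
      qed
      then show "q' (x + y) - q' y \<le> q (x + m) - h m" by simp
    qed
    then show ?thesis by simp
  qed
  have scale_le: "q' (r *\<^sub>R x) \<le> r * q' x" if "0 < r" for r x
  proof -
    have "q' (r *\<^sub>R x) / r \<le> q' x"
    proof (rule ge)
      fix m assume m: "m \<in> C"
      have "q' (r *\<^sub>R x) \<le> r * (q (x + m) - h m)"
        using le[OF Cscale[of r m], of "r *\<^sub>R x"] m that hscale[of r m]
          sublinear_scale[OF q, of r "x + m"] by (simp add: algebra_simps)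
      then show "q' (r *\<^sub>R x) / r \<le> q (x + m) - h m"
        using that by (simp add: field_simps)
    qed
    then show ?thesis using that by (simp add: field_simps)
  qed
  have q'0: "q' 0 = 0"
    using le[OF C0, of 0] ge[of 0 0] hq h0 sublinear_0[OF q] by force
  have "q' (r *\<^sub>R x) = r * q' x" if "0 \<le> r" for r x
  proof (cases "r = 0")
    case False
    then have r: "0 < r" using that by simp
    have "q' x \<le> (1 / r) * q' (r *\<^sub>R x)"
      using scale_le[of "1 / r" "r *\<^sub>R x"] r by simp
    then have "r * q' x \<le> q' (r *\<^sub>R x)" using r by (simp add: field_simps)
    then show ?thesis using scale_le[OF r, of x] by simp
  qed (simp add: q'0)
  then have "sublinear q'" using add by (simp add: sublinear_def)
  moreover have "q' \<le> q" using le[OF C0] h0 by (simp add: le_fun_def)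
  moreover have "q' (- a) \<le> - h a" if "a \<in> C" for a
    using le[OF that, of "- a"] sublinear_0[OF q] by simp
  ultimately show thesis by (rule that)
qed

text \<open>A minimal sublinear functional is linear, so Zorn's lemma yields linear minorants.\<close>

lemma sublinear_linear_minorant:
  fixes p :: "'v::real_vector \<Rightarrow> real"
  assumes p: "sublinear p"
  obtains g where "linear g" "g \<le> p"
proof -
  define A where "A = {q. sublinear q \<and> q \<le> p}"
  \<comment> \<open>The order is reversed, so that the maximal elements of Zorn's lemma are the
    minimal sublinear functionals.\<close>
  define P where "P a b \<longleftrightarrow> b \<le> a" for a b :: "'v \<Rightarrow> real"
  have max: "\<exists>m\<in>A. \<forall>a\<in>A. P m a \<longrightarrow> a = m"
  proof (rule predicate_Zorn)
    show "partial_order_on A (relation_of P A)"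
      by (rule partial_order_on_relation_ofI) (auto simp: P_def)
  next
    fix C assume C: "C \<in> Chains (relation_of P A)"
    then have CA: "C \<subseteq> A" by (rule Chains_relation_of)
    have tot: "a \<le> b \<or> b \<le> a" if "a \<in> C" "b \<in> C" for a b
      using C that by (auto simp: Chains_def relation_of_def P_def)
    show "\<exists>u\<in>A. \<forall>a\<in>C. P a u"
    proof (cases "C = {}")
      case True
      then show ?thesis using p by (auto simp: A_def)
    next
      case False
      define u where "u x = (INF a\<in>C. a x)" for x
      \<comment> \<open>This lower bound does not depend on \<open>a\<close>, so the pointwise
        infimum of a chain is finite.\<close>
      have lb: "- p (- x) \<le> a x" if "a \<in> C" for a x
      proof -
        have "sublinear a" "a (- x) \<le> p (- x)" using that CA by (auto simp: A_def le_fun_def)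
        then show ?thesis using sublinear_minus[of a x] by linarith
      qed
      have le: "u x \<le> a x" if "a \<in> C" for a x
        unfolding u_def by (rule cINF_lower[OF bdd_belowI2 that]) (rule lb)
      have ge: "c \<le> u x" if "\<And>a. a \<in> C \<Longrightarrow> c \<le> a x" for c x
        unfolding u_def using False that by (intro cINF_greatest) auto
      have add: "u (x + y) \<le> u x + u y" for x y
      proof -
        have "u (x + y) - u y \<le> u x"
        proof (rule ge)
          fix a assume a: "a \<in> C"
          have "u (x + y) - a x \<le> u y"
          proof (rule ge)
            fix b assume b: "b \<in> C"
            \<comment> \<open>The infimum stays subadditive because a chain offers one member below
              both \<open>a\<close> and \<open>b\<close>.\<close>
            obtain c where c: "c \<in> C" "c \<le> a" "c \<le> b" using tot[OF a b] a b by blast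
            then have "c (x + y) \<le> c x + c y" using CA by (auto simp: A_def sublinear_def)
            then show "u (x + y) - a x \<le> b y"
              using le[OF c(1), of "x + y"] c(2,3) unfolding le_fun_def by (smt (verit))
          qed
          then show "u (x + y) - u y \<le> a x" by simp
        qed
        then show ?thesis by simp
      qed
      have "u (r *\<^sub>R x) = r * u x" if r: "0 \<le> r" for r x
      proof (rule antisym)
        have s: "a (r *\<^sub>R x) = r * a x" if "a \<in> C" for a
          using CA that r by (auto simp: A_def sublinear_def)
        show "r * u x \<le> u (r *\<^sub>R x)"
        proof (intro ge)
          fix a assume "a \<in> C"
          then show "r * u x \<le> a (r *\<^sub>R x)"
            unfolding s[OF \<open>a \<in> C\<close>] using le r by (intro mult_left_mono)
        qed
        show "u (r *\<^sub>R x) \<le> r * u x"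
        proof (cases "r = 0")
          case True
          obtain a where "a \<in> C" using \<open>C \<noteq> {}\<close> by blast
          then have "u 0 \<le> 0" using s[of a] le[of a 0] True by simp
          then show ?thesis using True by simp
        next
          case False
          then have "u (r *\<^sub>R x) / r \<le> u x"
          proof (intro ge)
            fix a assume "a \<in> C"
            then show "u (r *\<^sub>R x) / r \<le> a x"
              using le[of a "r *\<^sub>R x"] s[of a] r False by (simp add: field_simps)
          qed
          then show ?thesis using False r by (simp add: field_simps)
        qed
      qed
      with add have "sublinear u" by (simp add: sublinear_def)
      moreover have "u \<le> p"
      proof -
        obtain a where "a \<in> C" using False by blast
        then have "u \<le> a" "a \<le> p" using le CA by (auto simp: A_def intro: le_funI)
        then show ?thesis by (rule order_trans)
      qed
      ultimately show ?thesis
        unfolding A_def P_def by (intro bexI[of _ u] ballI le_funI le) auto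
    qed
  qed
  then obtain m where m: "sublinear m" "m \<le> p"
    and min: "\<And>q. sublinear q \<Longrightarrow> q \<le> m \<Longrightarrow> q = m"
  proof -
    obtain m where "m \<in> A" "\<And>a. a \<in> A \<Longrightarrow> P m a \<Longrightarrow> a = m"
      using max by blast
    then show thesis
      unfolding A_def P_def by (intro that[of m]) (blast intro: order_trans)+
  qed
  \<comment> \<open>The cone infimum of \<open>m\<close> along the ray through \<open>a\<close> lies
    below \<open>m\<close>, hence equals \<open>m\<close> by minimality; its value at
    \<open>- a\<close> gives \<open>m (- a) \<le> - m a\<close>.\<close>
  have neg: "m (- a) = - m a" for a
  proof -
    \<comment> \<open>The absolute value lets a range over all reals describe the ray of nonnegative
      multiples of \<open>a\<close>.\<close>
    define C where "C = range (\<lambda>t::real. \<bar>t\<bar> *\<^sub>R a)"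
    have mem: "t *\<^sub>R a \<in> C" if "0 \<le> t" for t
      using that unfolding C_def by (metis abs_of_nonneg rangeI)
    obtain q' where q': "sublinear q'" "q' \<le> m" "\<And>c. c \<in> C \<Longrightarrow> q' (- c) \<le> - m c"
    proof (rule sublinear_cone_inf[OF m(1), of C m])
      show "0 \<in> C" using mem[of 0] by simp
      show "b + c \<in> C" if "b \<in> C" "c \<in> C" for b c
        using that mem unfolding C_def by (auto simp flip: scaleR_add_left)
      show "r *\<^sub>R b \<in> C" if "0 \<le> r" "b \<in> C" for r b
        using that mem unfolding C_def by auto
      show "m (b + c) = m b + m c" if "b \<in> C" "c \<in> C" for b c
        using that sublinear_scale[OF m(1)] unfolding C_def
        by (auto simp flip: scaleR_add_left simp: distrib_right)
    qed (use m sublinear_scale in auto)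
    then have "m (- a) \<le> - m a"
      using min[OF q'(1,2)] mem[of 1] by auto
    then show ?thesis using sublinear_minus[OF m(1), of a] by linarith
  qed
  have "linear m"
  proof (rule linearI)
    fix x y
    show "m (x + y) = m x + m y"
      using sublinear_add[OF m(1), of x y] sublinear_add[OF m(1), of "x + y" "- y"] neg[of y]
      by simp
  next
    fix r x
    show "m (r *\<^sub>R x) = r *\<^sub>R m x"
      using sublinear_scale[OF m(1), of r x] sublinear_scale[OF m(1), of "- r" x]
        neg[of "r *\<^sub>R x"] by (cases "0 \<le> r") auto
  qed
  then show thesis using m(2) by (rule that)
qed

text \<open>With \<open>C = M\<close> and \<open>h = f\<close> the cone infimum yields a sublinear
  \<open>q \<le> p\<close> with \<open>q (- a) \<le> - f a\<close> on \<open>M\<close>. Any linear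
  minorant of \<open>q\<close> then dominates \<open>f\<close> on \<open>M\<close>, and since
  \<open>M\<close> contains the negatives it agrees with \<open>f\<close> there.\<close>

theorem hahn_banach_real:
  fixes p :: "'v::real_vector \<Rightarrow> real"
  assumes p: "sublinear p" and M: "subspace M"
    and fadd: "\<And>x y. x \<in> M \<Longrightarrow> y \<in> M \<Longrightarrow> f (x + y) = f x + f y"
    and fscale: "\<And>r x. x \<in> M \<Longrightarrow> f (r *\<^sub>R x) = r * f x"
    and fp: "\<And>x. x \<in> M \<Longrightarrow> f x \<le> p x"
  obtains g where "linear g" "g \<le> p" "\<And>x. x \<in> M \<Longrightarrow> g x = f x"
proof -
  obtain q where q: "sublinear q" "q \<le> p" "\<And>a. a \<in> M \<Longrightarrow> q (- a) \<le> - f a"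
  proof (rule sublinear_cone_inf[OF p, of M f])
    show "0 \<in> M" "\<And>a b. a \<in> M \<Longrightarrow> b \<in> M \<Longrightarrow> a + b \<in> M"
      "\<And>r a. a \<in> M \<Longrightarrow> r *\<^sub>R a \<in> M"
      using M by (simp_all add: subspace_def)
  qed (use fadd fscale fp in auto)
  obtain g where g: "linear g" "g \<le> q" using sublinear_linear_minorant[OF q(1)] .
  have lin: "g (- x) = - g x" for x using linear_neg[OF g(1)] .
  have le: "f x \<le> g x" if "x \<in> M" for x
  proof -
    have "g (- x) \<le> q (- x)" using g(2) by (simp add: le_fun_def)
    then show ?thesis using lin[of x] q(3)[OF that] by linarith
  qed
  have "g x = f x" if "x \<in> M" for x
  proof -
    have "- x \<in> M" using that M by (simp add: subspace_neg)
    then show ?thesis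
      using le[OF that] le[of "- x"] lin[of x] fscale[OF that, of "-1"] by simp
  qed
  moreover have "g \<le> p" using g(2) q(2) by (rule order_trans)
  ultimately show thesis using that g(1) by blast
qed

section \<open>Hahn-Banach over real and complex scalars\<close>

text \<open>The scalar fields: \<open>re = id\<close>, \<open>\<iota> = 0\<close> for the reals and \<open>re = Re\<close>, \<open>\<iota> = \<i>\<close>
  for the complex numbers.\<close>

locale rc_scalars =
  fixes re :: "'k::{real_normed_field, second_countable_topology} \<Rightarrow> real" and \<iota> :: 'k
  assumes re_linear: "linear re"
    and re_1: "re 1 = 1"
    and re_le: "re a \<le> norm a"
    and re_iota: "re \<iota> = 0"
    and re_decomp: "a = of_real (re a) - \<iota> * of_real (re (\<iota> * a))"
    and iota_sq: "\<iota> = 0 \<or> \<iota> * \<iota> = -1"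
begin

lemma re_of_real: "re (of_real r) = r"
  using linear_scale[OF re_linear, of r 1] re_1 by (simp add: of_real_def)

lemma re_iota_of_real: "re (\<iota> * of_real r) = 0"
  using linear_scale[OF re_linear, of r \<iota>] re_iota by (simp add: scaleR_conv_of_real mult.commute)

text \<open>The real part of \<open>f\<close> is extended to a real functional \<open>G\<close>, and
  the scalar-valued extension is recovered as \<open>G x - \<iota> G (\<iota> x)\<close>. For
  \<open>\<iota> = 0\<close> this is just \<open>G\<close>, so one argument serves both
  fields.\<close>

theorem hahn_banach:
  fixes sc :: "'k \<Rightarrow> 'v::real_vector \<Rightarrow> 'v" and p :: "'v \<Rightarrow> real"
  assumes vs: "vector_space sc"
    and sc_real: "\<And>r x. sc (of_real r) x = r *\<^sub>R x"
    and padd: "\<And>x y. p (x + y) \<le> p x + p y"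
    and pscale: "\<And>c x. p (sc c x) = norm c * p x"
    and M: "module.subspace sc M"
    and fadd: "\<And>x y. x \<in> M \<Longrightarrow> y \<in> M \<Longrightarrow> f (x + y) = f x + f y"
    and fscale: "\<And>c x. x \<in> M \<Longrightarrow> f (sc c x) = c * f x"
    and fp: "\<And>x. x \<in> M \<Longrightarrow> norm (f x) \<le> p x"
  obtains g :: "'v \<Rightarrow> 'k"
  where "\<And>x y. g (x + y) = g x + g y" "\<And>c x. g (sc c x) = c * g x"
    "\<And>x. norm (g x) \<le> p x" "\<And>x. x \<in> M \<Longrightarrow> g x = f x"
proof -
  interpret vector_space sc by (rule vs)
  have M_sc: "sc c x \<in> M" if "x \<in> M" for c x using M that by (simp add: subspace_scale)
  have "sublinear p"
  proof -
    have "p (r *\<^sub>R x) = \<bar>r\<bar> * p x" for r x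
      using pscale[of "of_real r" x] sc_real by simp
    then show ?thesis using padd by (simp add: sublinear_def)
  qed
  moreover have "Real_Vector_Spaces.subspace M"
    using subspace_0[OF M] subspace_add[OF M] M_sc[of _ "of_real r" for r] sc_real
    by (auto simp: Real_Vector_Spaces.subspace_def)
  moreover have "re (f (x + y)) = re (f x) + re (f y)" if "x \<in> M" "y \<in> M" for x y
    using fadd[OF that] linear_add[OF re_linear] by simp
  moreover have "re (f (r *\<^sub>R x)) = r * re (f x)" if "x \<in> M" for r x
    using fscale[OF that, of "of_real r"] linear_scale[OF re_linear, of r "f x"] sc_real
    by (simp add: scaleR_conv_of_real)
  moreover have "re (f x) \<le> p x" if "x \<in> M" for x
    using re_le[of "f x"] fp[OF that] by linarith
  ultimately have "\<exists>G. linear G \<and> G \<le> p \<and> (\<forall>x\<in>M. G x = re (f x))"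
    by (rule hahn_banach_real[of p M "\<lambda>x. re (f x)"]) auto
  then obtain G where G: "linear G" "G \<le> p" and GM: "\<And>x. x \<in> M \<Longrightarrow> G x = re (f x)"
    by blast
  define g where "g x = of_real (G x) - \<iota> * of_real (G (sc \<iota> x))" for x
  have gadd: "g (x + y) = g x + g y" for x y
    using G(1) by (simp add: g_def linear_add scale_right_distrib algebra_simps)
  have greal: "g (sc (of_real r) x) = of_real r * g x" for r x
    using linear_scale[OF G(1), of r x] linear_scale[OF G(1), of r "sc \<iota> x"]
    by (simp add: g_def sc_real[symmetric] algebra_simps)
  have giota: "g (sc \<iota> x) = \<iota> * g x" for x
  proof (cases "\<iota> = 0")
    case True
    then show ?thesis using linear_0[OF G(1)] by (simp add: g_def)
  next
    case False
    then have i: "\<iota> * \<iota> = -1" using iota_sq by blast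
    have "sc \<iota> (sc \<iota> x) = - x" using i by simp
    moreover have "\<iota> * (\<iota> * a) = - a" for a
      by (simp add: i mult.assoc[symmetric])
    ultimately show ?thesis
      using linear_neg[OF G(1), of x] by (simp add: g_def right_diff_distrib)
  qed
  have gscale: "g (sc c x) = c * g x" for c x
  proof -
    let ?a = "of_real (re c) :: 'k" and ?b = "of_real (- re (\<iota> * c)) :: 'k"
    have c: "c = ?a + \<iota> * ?b" using re_decomp[of c] by simp
    have "g (sc (?a + \<iota> * ?b) x) = g (sc ?a x + sc \<iota> (sc ?b x))"
      by (simp only: scale_left_distrib scale_scale)
    also have "\<dots> = ?a * g x + \<iota> * (?b * g x)"
      by (simp only: gadd giota greal)
    also have "\<dots> = (?a + \<iota> * ?b) * g x" by (simp only: algebra_simps)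
    finally show ?thesis using c by simp
  qed
  have re_g: "re (g x) = G x" for x
    by (simp add: g_def linear_diff[OF re_linear] re_of_real re_iota_of_real)
  have gp: "norm (g x) \<le> p x" for x
  proof (cases "g x = 0")
    case True
    have "0 = p 0" using pscale[of 0 0] by simp
    also have "\<dots> \<le> 2 * p x"
      using padd[of x "- x"] pscale[of "-1" x] by simp
    finally show ?thesis using True by simp
  next
    case False
    \<comment> \<open>Rotation by the unimodular \<open>u\<close> makes the value of
      \<open>g\<close> real and nonnegative, so the bound on the real part bounds the norm.\<close>
    define u where "u = of_real (norm (g x)) / g x"
    have u: "norm u = 1" "u * g x = of_real (norm (g x))"
      using False by (simp_all add: u_def norm_divide)
    have "norm (g x) = re (g (sc u x))" by (simp add: gscale u re_of_real)
    also have "\<dots> \<le> p (sc u x)" using G(2) by (simp add: re_g le_fun_def)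
    finally show ?thesis by (simp add: pscale u)
  qed
  have "g x = f x" if "x \<in> M" for x
    using GM[OF that] GM[OF M_sc[OF that, of \<iota>]] fscale[OF that, of \<iota>] re_decomp[of "f x"]
    by (simp add: g_def)
  then show thesis using that gadd gscale gp by blast
qed

text \<open>On the line through \<open>x0\<close> the functional sending \<open>c x0\<close> to
  \<open>c * p x0\<close> is dominated by \<open>p\<close>, with equality of norms, and is extended
  from there. If \<open>p x0 = 0\<close>, the zero functional serves.\<close>

corollary seminorm_functional:
  fixes sc :: "'k \<Rightarrow> 'v::real_vector \<Rightarrow> 'v" and p :: "'v \<Rightarrow> real"
  assumes vs: "vector_space sc"
    and sc_real: "\<And>r x. sc (of_real r) x = r *\<^sub>R x"
    and padd: "\<And>x y. p (x + y) \<le> p x + p y"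
    and pscale: "\<And>c x. p (sc c x) = norm c * p x"
  obtains g :: "'v \<Rightarrow> 'k"
  where "\<And>x y. g (x + y) = g x + g y" "\<And>c x. g (sc c x) = c * g x"
    "\<And>x. norm (g x) \<le> p x" "g x0 = of_real (p x0)"
proof -
  interpret vector_space sc by (rule vs)
  have p0: "p 0 = 0" using pscale[of 0 0] by simp
  have pos: "0 \<le> p x" for x
    using padd[of x "- x"] pscale[of "-1" x] p0 by simp
  show thesis
  proof (cases "p x0 = 0")
    case True
    then show thesis using that[of "\<lambda>_. 0"] pos by simp
  next
    case False
    then have "x0 \<noteq> 0" using p0 by auto
    then have inj: "sc c x0 = sc d x0 \<longleftrightarrow> c = d" for c d by (simp add: scale_right_imp_eq)
    define f where "f y = (THE c. y = sc c x0) * of_real (p x0)" for y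
    have f: "f (sc c x0) = c * of_real (p x0)" for c
      unfolding f_def by (simp only: inj the_eq_trivial the_sym_eq_trivial)
    define M where "M = range (\<lambda>c. sc c x0)"
    have M: "subspace M"
    proof (rule subspaceI)
      show "0 \<in> M" unfolding M_def using scale_zero_left[of x0] by (metis rangeI)
      show "x + y \<in> M" if "x \<in> M" "y \<in> M" for x y
        using that by (auto simp: M_def simp flip: scale_left_distrib)
      show "sc c x \<in> M" if "x \<in> M" for c x
        using that by (auto simp: M_def)
    qed
    obtain g where "\<And>x y. g (x + y) = g x + g y" "\<And>c x. g (sc c x) = c * g x"
      "\<And>x. norm (g x) \<le> p x" and g: "\<And>x. x \<in> M \<Longrightarrow> g x = f x"
    proof (rule hahn_banach[OF vs sc_real padd pscale M, of f])
      show "f (x + y) = f x + f y" if "x \<in> M" "y \<in> M" for x y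
        using that f by (auto simp: M_def scale_left_distrib[symmetric] distrib_right)
      show "f (sc c x) = c * f x" if "x \<in> M" for x c
        using that f by (auto simp: M_def)
      show "norm (f x) \<le> p x" if "x \<in> M" for x
        using that f pos by (auto simp: M_def norm_mult pscale)
    qed blast
    moreover have "g x0 = of_real (p x0)"
    proof -
      have "sc 1 x0 \<in> M" unfolding M_def by (rule rangeI)
      from g[OF this] show ?thesis using f[of 1] by simp
    qed
    ultimately show thesis using that by blast
  qed
qed

end

section \<open>Seminorms, distances and functionals in a normed space over \<open>'k\<close>\<close>

context normed_space_over
begin

lemma bounded_bilinear_scale: "bounded_bilinear sc"
proof
  show "sc (r *\<^sub>R a) b = r *\<^sub>R sc a b" for r a b
    by (simp add: scaleR_conv_of_real scale_of_real flip: scale_scale)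
  show "sc a (r *\<^sub>R b) = r *\<^sub>R sc a b" for r a b
    using scale_left_commute[of a "of_real r" b] by (simp only: scale_of_real)
  show "\<exists>K. \<forall>a b. norm (sc a b) \<le> norm a * norm b * K"
    by (intro exI[of _ 1]) (simp add: norm_scale)
qed (simp_all add: scale_left_distrib scale_right_distrib)

text \<open>Scalar multiplication is jointly continuous, so limits of combinations with scalars from
  a dense set give all scalars. This lets countable sets have closed subspaces as closures.\<close>

lemma subspace_closure_of_dense_scalars:
  assumes "D \<noteq> {}" and Q: "closure Q = UNIV"
    and add: "\<And>x y. x \<in> D \<Longrightarrow> y \<in> D \<Longrightarrow> x + y \<in> D"
    and scale: "\<And>q x. q \<in> Q \<Longrightarrow> x \<in> D \<Longrightarrow> sc q x \<in> D"
  shows "subspace (closure D)"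
proof -
  have sc: "sc c x \<in> closure D" if x: "x \<in> closure D" for c x
  proof -
    obtain xs where xs: "\<And>n. xs n \<in> D" "xs \<longlonglongrightarrow> x"
      using x unfolding closure_sequential by blast
    have "c \<in> closure Q" using Q by simp
    then obtain cs where cs: "\<And>n. cs n \<in> Q" "cs \<longlonglongrightarrow> c"
      unfolding closure_sequential by blast
    have "(\<lambda>n. sc (cs n) (xs n)) \<longlonglongrightarrow> sc c x"
      by (rule bounded_bilinear.tendsto[OF bounded_bilinear_scale cs(2) xs(2)])
    then show ?thesis
      unfolding closure_sequential using scale[OF cs(1) xs(1)] by (intro exI conjI allI)
  qed
  have "x + y \<in> closure D" if xy: "x \<in> closure D" "y \<in> closure D" for x y
  proof -
    obtain xs ys where xs: "\<And>n. xs n \<in> D" "xs \<longlonglongrightarrow> x" and ys: "\<And>n. ys n \<in> D" "ys \<longlonglongrightarrow> y"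
      using xy unfolding closure_sequential by blast
    show ?thesis
      unfolding closure_sequential using add[OF xs(1) ys(1)] tendsto_add[OF xs(2) ys(2)]
      by (intro exI conjI allI)
  qed
  moreover obtain x where "x \<in> D" using assms(1) by blast
  then have "0 \<in> closure D" using sc[of x 0] closure_subset by auto
  ultimately show ?thesis using sc by (simp add: subspace_def)
qed

text \<open>The distance to \<open>Z\<close> is the seminorm induced by the quotient by
  \<open>Z\<close>; this lemma and \<open>infdist_add\<close> make it available as a dominating
  seminorm. One inequality is homogeneity of the distance, the other is the same for the inverse
  scalar.\<close>

lemma infdist_scale:
  assumes Z: "subspace Z"
  shows "infdist (sc c x) Z = norm c * infdist x Z"
proof -
  have ne: "Z \<noteq> {}" using subspace_0[OF Z] by blast
  have le: "infdist (sc c x) Z \<le> norm c * infdist x Z" if "c \<noteq> 0" for c x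
  proof -
    have "infdist (sc c x) Z / norm c \<le> infdist x Z"
      unfolding infdist_notempty[OF ne, of x]
    proof (rule cINF_greatest[OF ne])
      fix z assume "z \<in> Z"
      then have "infdist (sc c x) Z \<le> dist (sc c x) (sc c z)"
        by (intro infdist_le subspace_scale[OF Z])
      also have "\<dots> = norm c * dist x z"
        by (simp add: dist_norm norm_scale flip: scale_right_diff_distrib)
      finally show "infdist (sc c x) Z / norm c \<le> dist x z"
        using that by (simp add: field_simps)
    qed
    then show ?thesis using that by (simp add: field_simps)
  qed
  show ?thesis
  proof (cases "c = 0")
    case False
    have "norm c * infdist x Z = norm c * infdist (sc (inverse c) (sc c x)) Z"
      using False by simp
    also have "\<dots> \<le> norm c * (norm (inverse c) * infdist (sc c x) Z)"
      using le[of "inverse c" "sc c x"] False by (intro mult_left_mono) auto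
    also have "\<dots> = infdist (sc c x) Z" using False by (simp add: norm_inverse)
    finally show ?thesis using le[OF False, of x] by simp
  qed (simp add: subspace_0[OF Z])
qed

lemma infdist_add:
  assumes Z: "subspace Z"
  shows "infdist (x + y) Z \<le> infdist x Z + infdist y Z"
proof -
  have ne: "Z \<noteq> {}" using subspace_0[OF Z] by blast
  have *: "infdist (x + y) Z \<le> dist x a + dist y b" if "a \<in> Z" "b \<in> Z" for a b
  proof -
    have "infdist (x + y) Z \<le> dist (x + y) (a + b)"
      by (intro infdist_le subspace_add[OF Z] that)
    also have "\<dots> \<le> dist x a + dist y b" by (rule dist_triangle_add)
    finally show ?thesis .
  qed
  have "infdist (x + y) Z - infdist y Z \<le> infdist x Z"
    unfolding infdist_notempty[OF ne, of x]
  proof (rule cINF_greatest[OF ne])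
    fix a assume a: "a \<in> Z"
    have "infdist (x + y) Z - dist x a \<le> infdist y Z"
      unfolding infdist_notempty[OF ne, of y]
      using *[OF a] by (intro cINF_greatest[OF ne]) (simp add: algebra_simps)
    then show "infdist (x + y) Z - infdist y Z \<le> dist x a" by simp
  qed
  then show ?thesis by simp
qed

lemma dual_spaceI:
  assumes "\<And>x y. f (x + y) = f x + f y" "\<And>c x. f (sc c x) = c * f x"
    "\<And>x. norm (f x) \<le> norm x * B"
  shows "f \<in> dual_space sc"
proof -
  have "bounded_linear f"
    using assms(2)[of "of_real r" for r]
    by (intro bounded_linear_intro[where K = B] assms(1,3))
      (simp add: scale_of_real scaleR_conv_of_real)
  then show ?thesis using assms(2) by (simp add: dual_space_def bounded_linear_over_def)
qed

end

lemma dual_space_bounded_linear: "f \<in> dual_space sc \<Longrightarrow> bounded_linear f"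
  and dual_space_scale: "f \<in> dual_space sc \<Longrightarrow> f (sc c x) = c * f x"
  by (auto simp: dual_space_def bounded_linear_over_def)

locale rc_space = rc_scalars re \<iota> + normed_space_over sc
  for re :: "'k::{real_normed_field, second_countable_topology} \<Rightarrow> real" and \<iota> :: 'k
    and sc :: "'k \<Rightarrow> 'a::banach \<Rightarrow> 'a"
begin

lemma norming_functional:
  obtains f where "f \<in> dual_space sc" "\<And>x. norm (f x) \<le> norm x" "f x0 = of_real (norm x0)"
proof -
  obtain f where "\<And>x y. f (x + y) = f x + f y" "\<And>c x. f (sc c x) = c * f x"
    "\<And>x. norm (f x) \<le> norm x" "f x0 = of_real (norm x0)"
    using seminorm_functional[OF vector_space_axioms scale_of_real norm_triangle_ineq norm_scale]
    by blast
  then show thesis using that dual_spaceI[of f 1] by simp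
qed

text \<open>A functional dominated by the distance to \<open>Z\<close> vanishes on \<open>Z\<close>;
  it can attain that distance at \<open>x0\<close>, which is positive because \<open>Z\<close> is
  closed.\<close>

lemma separating_functional:
  assumes Z: "subspace Z" "closed Z" and x0: "x0 \<notin> Z"
  obtains f where "f \<in> dual_space sc" "\<And>z. z \<in> Z \<Longrightarrow> f z = 0" "f x0 \<noteq> 0"
proof -
  have ne: "Z \<noteq> {}" using subspace_0[OF Z(1)] by blast
  obtain f where f: "\<And>x y. f (x + y) = f x + f y" "\<And>c x. f (sc c x) = c * f x"
    "\<And>x. norm (f x) \<le> infdist x Z" "f x0 = of_real (infdist x0 Z)"
    using seminorm_functional[OF vector_space_axioms scale_of_real infdist_add[OF Z(1)]
        infdist_scale[OF Z(1)]] by blast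
  have "norm (f x) \<le> norm x * 1" for x
    using f(3)[of x] infdist_le[OF subspace_0[OF Z(1)], of x] by simp
  then have "f \<in> dual_space sc" by (rule dual_spaceI[OF f(1,2)])
  moreover have "f z = 0" if "z \<in> Z" for z using f(3)[of z] that by simp
  moreover have "f x0 \<noteq> 0"
    using f(4) x0 in_closed_iff_infdist_zero[OF Z(2) ne] by simp
  ultimately show thesis by (rule that)
qed

end

subsection \<open>Separable complements in reflexive spaces\<close>

text \<open>Countably many operations are applied repeatedly; the union of the stages is closed
  because two of its elements already lie in a common stage.\<close>

lemma countable_superset_closed:
  assumes A: "countable A" and F: "countable F"
  obtains B where "countable B" "A \<subseteq> B" "\<And>f a b. f \<in> F \<Longrightarrow> a \<in> B \<Longrightarrow> b \<in> B \<Longrightarrow> f a b \<in> B"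
proof -
  define step where "step S = S \<union> (\<lambda>(f, a, b). f a b) ` (F \<times> S \<times> S)" for S
  define s where "s n = (step ^^ n) A" for n
  have s_Suc: "s (Suc n) = step (s n)" for n by (simp add: s_def)
  have "countable (s n)" for n
    by (induction n) (use A F in \<open>auto simp: s_Suc s_def step_def\<close>)
  then have "countable (\<Union>n. s n)" by simp
  moreover have "A \<subseteq> (\<Union>n. s n)"
    using s_def[of 0] by auto
  moreover have "f a b \<in> (\<Union>n. s n)" if f: "f \<in> F" and ab: "a \<in> (\<Union>n. s n)" "b \<in> (\<Union>n. s n)" for f a b
  proof -
    have "mono s"
      by (intro incseq_SucI) (auto simp: s_Suc step_def)
    then have mono: "s m \<subseteq> s (max m n)" "s n \<subseteq> s (max m n)" for m n
      by (simp_all add: monoD)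
    from ab obtain m n where "a \<in> s m" "b \<in> s n"
      by blast
    then have "a \<in> s (max m n)" "b \<in> s (max m n)" by (auto intro: subsetD[OF mono(1)] subsetD[OF mono(2)])
    then have "f a b \<in> s (Suc (max m n))"
      using f unfolding s_Suc step_def by (intro UnI2 image_eqI[of _ _ "(f, a, b)"]) auto
    then show ?thesis by (rule UN_I[OF UNIV_I])
  qed
  ultimately show thesis by (rule that)
qed

text \<open>If every vector of the unit ball fell short of \<open>norm f - e\<close>, homogeneity
  would make this number a bound for the operator norm.\<close>

lemma exists_almost_norming_vector:
  fixes f :: "'a::real_normed_vector \<Rightarrow>\<^sub>L 'b::real_normed_vector"
  assumes e: "0 < e"
  shows "\<exists>x. norm x \<le> 1 \<and> norm f - e \<le> norm (f x)"
proof (rule ccontr)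
  assume "\<not> ?thesis"
  then have less: "norm (f x) < norm f - e" if "norm x \<le> 1" for x using that by force
  have "norm f \<le> norm f - e"
  proof (rule norm_blinfun_bound)
    show "0 \<le> norm f - e" using less[of 0] by simp
    show "norm (f x) \<le> (norm f - e) * norm x" for x
      using less[of "sgn x"]
      by (cases "x = 0") (auto simp: sgn_div_norm blinfun.scaleR_right norm_sgn field_simps)
  qed
  then show False using e by simp
qed

text \<open>This turns the bounded maps into \<open>'k\<close> into a normed space over
  \<open>'k\<close>, so that Hahn-Banach applies to functionals on them. Its elements are only
  real-linear; compatibility with \<open>sc\<close> is tracked by membership in
  \<open>dual_space sc\<close>.\<close>

definition scale_blinfun ::
    "'k::real_normed_field \<Rightarrow> ('a::real_normed_vector \<Rightarrow>\<^sub>L 'k) \<Rightarrow> 'a \<Rightarrow>\<^sub>L 'k"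
  where "scale_blinfun c f = blinfun_mult_right c o\<^sub>L f"

lemma scale_blinfun_apply [simp]: "scale_blinfun c f x = c * f x"
  by (simp add: scale_blinfun_def)

lemma normed_space_over_scale_blinfun:
  "normed_space_over (scale_blinfun :: 'k::real_normed_field \<Rightarrow> ('a::real_normed_vector \<Rightarrow>\<^sub>L 'k) \<Rightarrow> _)"
proof
  fix c :: 'k and f :: "'a \<Rightarrow>\<^sub>L 'k"
  have le: "norm (scale_blinfun d g) \<le> norm d * norm g" for d and g :: "'a \<Rightarrow>\<^sub>L 'k"
    by (rule norm_blinfun_bound)
      (simp_all add: norm_mult mult.assoc mult_left_mono norm_blinfun)
  show "norm (scale_blinfun c f) = norm c * norm f"
  proof (cases "c = 0")
    case True
    then show ?thesis using le[of 0 f] by simp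
  next
    case False
    then have "scale_blinfun (inverse c) (scale_blinfun c f) = f"
      by (intro blinfun_eqI) simp
    then have "norm c * norm f \<le> norm c * (norm (inverse c) * norm (scale_blinfun c f))"
      using le[of "inverse c" "scale_blinfun c f"] by (intro mult_left_mono) auto
    also have "\<dots> = norm (scale_blinfun c f)" using False by (simp add: norm_inverse)
    finally show ?thesis using le[of c f] by simp
  qed
qed (auto intro!: blinfun_eqI simp: blinfun.bilinear_simps algebra_simps scaleR_conv_of_real)

lemma dual_space_Blinfun:
  assumes "f \<in> dual_space sc"
  shows "blinfun_apply (Blinfun f) = f" "norm (Blinfun f) = onorm f"
  using dual_space_bounded_linear[OF assms]
  by (simp_all add: bounded_linear_Blinfun_apply norm_blinfun.rep_eq)

context rc_space
begin

sublocale dual: normed_space_over "scale_blinfun :: 'k \<Rightarrow> ('a \<Rightarrow>\<^sub>L 'k) \<Rightarrow> _"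
  by (rule normed_space_over_scale_blinfun)

text \<open>A countable set of pairs (vector, functional) is closed under sums, under a countable
  dense set of scalars, and under passing from \<open>(x, f)\<close> to almost norming vectors of
  \<open>f\<close> paired with a norming functional of \<open>x\<close>. The two projections are
  \<open>D\<close> and \<open>G\<close>.\<close>

lemma mutually_norming_sets:
  assumes "countable D0" "D0 \<noteq> {}"
  obtains D :: "'a set" and G :: "('a \<Rightarrow>\<^sub>L 'k) set"
  where "countable D" "D0 \<subseteq> D" "subspace (closure D)"
    "dual.subspace (closure G)" "\<And>g. g \<in> G \<Longrightarrow> blinfun_apply g \<in> dual_space sc"
    "\<And>x. x \<in> D \<Longrightarrow> \<exists>g\<in>G. norm g \<le> 1 \<and> norm (blinfun_apply g x) = norm x"
    "\<And>g e. g \<in> G \<Longrightarrow> 0 < e \<Longrightarrow> \<exists>x\<in>D. norm x \<le> 1 \<and> norm g - e \<le> norm (blinfun_apply g x)"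
proof -
  obtain Q :: "'k set" where Q: "countable Q" "closure Q = UNIV"
  proof -
    obtain Q :: "'k set" where Q: "countable Q"
      "\<And>X. open X \<Longrightarrow> X \<noteq> {} \<Longrightarrow> \<exists>d\<in>Q. d \<in> X"
      using countable_dense_setE by blast
    then have "closure Q = UNIV" by (auto simp: closure_iff_nhds_not_empty) blast
    then show thesis using Q(1) that by blast
  qed
  define V where "V = {g :: 'a \<Rightarrow>\<^sub>L 'k. blinfun_apply g \<in> dual_space sc}"
  have "\<exists>g\<in>V. norm g \<le> 1 \<and> norm (blinfun_apply g x) = norm x" for x
  proof -
    obtain f where f: "f \<in> dual_space sc" "\<And>x. norm (f x) \<le> norm x" "f x = of_real (norm x)"
      using norming_functional[of x] by blast
    have "norm (Blinfun f) \<le> 1"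
      by (rule norm_blinfun_bound) (simp_all add: dual_space_Blinfun(1)[OF f(1)] f(2))
    then show ?thesis
      using f by (intro bexI[of _ "Blinfun f"]) (simp_all add: V_def dual_space_Blinfun(1)[OF f(1)])
  qed
  then obtain N where N: "\<And>x. N x \<in> V" "\<And>x. norm (N x) \<le> 1" "\<And>x. norm (blinfun_apply (N x) x) = norm x"
    by metis
  have "\<forall>g :: 'a \<Rightarrow>\<^sub>L 'k. \<forall>n. \<exists>x. norm x \<le> 1 \<and> norm g - inverse (real (Suc n)) \<le> norm (blinfun_apply g x)"
    by (intro allI exists_almost_norming_vector) simp
  then obtain m where m: "\<And>g n. norm (m g n) \<le> 1"
    "\<And>g :: 'a \<Rightarrow>\<^sub>L 'k. \<And>n. norm g - inverse (real (Suc n)) \<le> norm (blinfun_apply g (m g n))"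
    by metis
  \<comment> \<open>Working with pairs treats vectors and functionals in a single closure; the unary
    operations ignore their second argument. The index \<open>n\<close> runs through the tolerances
    \<open>1 / (n + 1)\<close>.\<close>
  define F where "F = {\<lambda>(x, f) (y, g). (x + y, f + g)}
    \<union> (\<lambda>q (x, f) _. (sc q x, scale_blinfun q f)) ` Q
    \<union> range (\<lambda>n (x, f) _. (m f n, N x))"
  have "countable (D0 \<times> {0 :: 'a \<Rightarrow>\<^sub>L 'k})" "countable F"
    using assms Q(1) by (auto simp: F_def)
  then obtain B where B: "countable B" "D0 \<times> {0} \<subseteq> B"
    "\<And>f a b. f \<in> F \<Longrightarrow> a \<in> B \<Longrightarrow> b \<in> B \<Longrightarrow> f a b \<in> B"
    using countable_superset_closed by metis
  have V: "0 \<in> V" "\<And>f g. f \<in> V \<Longrightarrow> g \<in> V \<Longrightarrow> f + g \<in> V" "\<And>c f. f \<in> V \<Longrightarrow> scale_blinfun c f \<in> V"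
    by (auto simp: V_def dual_space_def bounded_linear_over_def algebra_simps
        blinfun.bounded_linear_right blinfun.bilinear_simps)
  \<comment> \<open>The closed superset \<open>B\<close> may contain pairs whose functional is not
    in the dual space. Intersecting with \<open>V\<close> removes them, and all operations preserve
    \<open>V\<close>.\<close>
  define B' where "B' = B \<inter> UNIV \<times> V"
  have Fs: "(x + y, f + g) \<in> B'" "(m f n, N x) \<in> B'"
    "q \<in> Q \<Longrightarrow> (sc q x, scale_blinfun q f) \<in> B'"
    if "(x, f) \<in> B'" "(y, g) \<in> B'" for x f y g q n
  proof -
    have b: "(x, f) \<in> B" "(y, g) \<in> B" "f \<in> V" "g \<in> V" using that by (auto simp: B'_def)
    have "(\<lambda>(x, f) (y, g). (x + y, f + g)) (x, f) (y, g) \<in> B"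
      by (rule B(3)[OF _ b(1,2)]) (auto simp: F_def)
    then show "(x + y, f + g) \<in> B'" using V(2) b by (simp add: B'_def)
    have "(\<lambda>(x, f) _. (m f n, N x)) (x, f) (y, g) \<in> B"
      by (rule B(3)[OF _ b(1,2)]) (auto simp: F_def)
    then show "(m f n, N x) \<in> B'" using N(1) by (simp add: B'_def)
    assume "q \<in> Q"
    then have "(\<lambda>(x, f) _. (sc q x, scale_blinfun q f)) \<in> F"
      by (auto simp: F_def)
    from B(3)[OF this b(1,2)] have "(sc q x, scale_blinfun q f) \<in> B" by simp
    then show "(sc q x, scale_blinfun q f) \<in> B'" using V(3) b by (simp add: B'_def)
  qed
  define D where "D = fst ` B'"
  define G where "G = snd ` B'"
  have D0: "D0 \<subseteq> D"
  proof
    fix x assume "x \<in> D0"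
    then have "(x, 0) \<in> B'" using B(2) V(1) by (auto simp: B'_def)
    then show "x \<in> D" by (force simp: D_def)
  qed
  show thesis
  proof (rule that[of D G])
    show "countable D" using B(1) by (simp add: D_def B'_def)
    show "D0 \<subseteq> D" by (rule D0)
    have ne: "D \<noteq> {}" using D0 assms(2) by blast
    show "subspace (closure D)"
    proof (rule subspace_closure_of_dense_scalars[OF ne Q(2)])
      show "x + y \<in> D" if xy: "x \<in> D" "y \<in> D" for x y
      proof -
        obtain f g where "(x, f) \<in> B'" "(y, g) \<in> B'" using xy by (auto simp: D_def)
        from Fs(1)[OF this] show ?thesis unfolding D_def by (rule image_eqI[rotated]) simp
      qed
      show "sc q x \<in> D" if q: "q \<in> Q" and x: "x \<in> D" for q x
      proof -
        obtain f where "(x, f) \<in> B'" using x by (auto simp: D_def)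
        from Fs(3)[OF this this q] show ?thesis unfolding D_def by (rule image_eqI[rotated]) simp
      qed
    qed
    have "G \<noteq> {}" using ne by (auto simp: D_def G_def)
    then show "dual.subspace (closure G)"
    proof (rule dual.subspace_closure_of_dense_scalars[OF _ Q(2)])
      show "f + g \<in> G" if fg: "f \<in> G" "g \<in> G" for f g
      proof -
        obtain x y where "(x, f) \<in> B'" "(y, g) \<in> B'" using fg by (auto simp: G_def)
        from Fs(1)[OF this] show ?thesis unfolding G_def by (rule image_eqI[rotated]) simp
      qed
      show "scale_blinfun q f \<in> G" if q: "q \<in> Q" and f: "f \<in> G" for q f
      proof -
        obtain x where "(x, f) \<in> B'" using f by (auto simp: G_def)
        from Fs(3)[OF this this q] show ?thesis unfolding G_def by (rule image_eqI[rotated]) simp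
      qed
    qed
    show "blinfun_apply g \<in> dual_space sc" if "g \<in> G" for g
      using that by (auto simp: G_def B'_def V_def)
    show "\<exists>g\<in>G. norm g \<le> 1 \<and> norm (blinfun_apply g x) = norm x" if x: "x \<in> D" for x
    proof -
      obtain f where "(x, f) \<in> B'" using x by (auto simp: D_def)
      then have "(m f 0, N x) \<in> B'" using Fs(2) by blast
      then have "N x \<in> G" by (force simp: G_def)
      then show ?thesis using N(2,3) by blast
    qed
    show "\<exists>x\<in>D. norm x \<le> 1 \<and> norm g - e \<le> norm (blinfun_apply g x)" if g: "g \<in> G" and e: "0 < e" for g e
    proof -
      obtain n where n: "inverse (real (Suc n)) < e" using reals_Archimedean[OF e] by blast
      obtain x where "(x, g) \<in> B'" using g by (auto simp: G_def)
      then have "(m g n, N x) \<in> B'" using Fs(2) by blast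
      then have "m g n \<in> D" by (force simp: D_def)
      moreover have "norm g - e \<le> norm (blinfun_apply g (m g n))" using m(2)[of g n] n by linarith
      ultimately show ?thesis using m(1) by blast
    qed
  qed
qed

section \<open>The norm-one projection onto a separable subspace\<close>

text \<open>For mutually norming \<open>D\<close> and \<open>G\<close> the annihilator of \<open>G\<close> is a complement of \<open>Z = closure D\<close>. Every \<open>x\<close> acts on \<open>closure G\<close>,
  where the norm is the norm of the restriction to \<open>Z\<close>; a Hahn-Banach extension that is dominated
  by the latter is represented, by reflexivity, by a vector that must lie in \<open>Z\<close>.\<close>

theorem separable_complement:
  assumes reflexive: "reflexive_space sc" and D0: "countable D0" "D0 \<noteq> {}"
  obtains D P where "countable D" "D0 \<subseteq> D" "subspace (closure D)"
    "bounded_linear_over sc sc P" "\<And>x. norm (P x) \<le> norm x" "range P = closure D"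
    "\<And>z. z \<in> closure D \<Longrightarrow> P z = z"
proof -
  obtain D and G :: "('a \<Rightarrow>\<^sub>L 'k) set" where D: "countable D" "D0 \<subseteq> D" "subspace (closure D)"
    and G: "dual.subspace (closure G)" "\<And>g. g \<in> G \<Longrightarrow> blinfun_apply g \<in> dual_space sc"
    and GD: "\<And>x. x \<in> D \<Longrightarrow> \<exists>g\<in>G. norm g \<le> 1 \<and> norm (blinfun_apply g x) = norm x"
    and DG: "\<And>g e. g \<in> G \<Longrightarrow> 0 < e \<Longrightarrow> \<exists>x\<in>D. norm x \<le> 1 \<and> norm g - e \<le> norm (blinfun_apply g x)"
    using mutually_norming_sets[OF D0] by metis
  define Z where "Z = closure D"
  have DZ: "D \<subseteq> Z" and Z: "subspace Z" "closed Z" using D closure_subset by (auto simp: Z_def)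
  \<comment> \<open>A functional of \<open>G\<close> that norms a point of \<open>D\<close> does not
    see \<open>w\<close>; density extends this to \<open>Z\<close>. Hence the projection onto
    \<open>Z\<close> along the annihilator of \<open>G\<close> will not increase norms.\<close>
  have norm_le: "norm z \<le> norm (z + w)" if z: "z \<in> Z" and w: "\<And>g. g \<in> G \<Longrightarrow> blinfun_apply g w = 0" for z w
  proof -
    obtain zs where zs: "\<And>n. zs n \<in> D" "zs \<longlonglongrightarrow> z"
      using z unfolding Z_def closure_sequential by blast
    have "norm (zs n) \<le> norm (zs n + w)" for n
    proof -
      obtain g where g: "g \<in> G" "norm g \<le> 1" "norm (blinfun_apply g (zs n)) = norm (zs n)"
        using GD[OF zs(1)] by blast
      have "norm (zs n) = norm (blinfun_apply g (zs n + w))" by (simp add: g(3) w[OF g(1)] blinfun.add_right)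
      also have "\<dots> \<le> norm g * norm (zs n + w)" by (rule norm_blinfun)
      also have "\<dots> \<le> norm (zs n + w)" using mult_right_mono[OF g(2)] by fastforce
      finally show ?thesis .
    qed
    moreover have "(\<lambda>n. norm (zs n)) \<longlonglongrightarrow> norm z" "(\<lambda>n. norm (zs n + w)) \<longlonglongrightarrow> norm (z + w)"
      using zs(2) by (auto intro!: tendsto_intros)
    ultimately show ?thesis by (intro LIMSEQ_le) auto
  qed
  define S where "S = {z \<in> Z. norm z \<le> 1}"
  \<comment> \<open>\<open>p\<close> is the norm of the restriction to \<open>Z\<close>.\<close>
  define p where "p f = (SUP z\<in>S. norm (blinfun_apply f z))" for f :: "'a \<Rightarrow>\<^sub>L 'k"
  have S0: "0 \<in> S" using subspace_0[OF Z(1)] by (simp add: S_def)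
  have le_norm: "norm (blinfun_apply f z) \<le> norm f" if "z \<in> S" for f :: "'a \<Rightarrow>\<^sub>L 'k" and z
    using norm_blinfun[of f z] mult_left_mono[of "norm z" 1 "norm f"] that by (simp add: S_def)
  have p_ge: "norm (blinfun_apply f z) \<le> p f" if "z \<in> S" for f z
    unfolding p_def using le_norm by (intro cSUP_upper[OF that] bdd_aboveI2)
  have p_le: "p f \<le> c" if "\<And>z. z \<in> S \<Longrightarrow> norm (blinfun_apply f z) \<le> c" for f c
    unfolding p_def using S0 that by (intro cSUP_least) auto
  have p_norm: "p f \<le> norm f" for f by (rule p_le[OF le_norm])
  have p_pos: "0 \<le> p f" for f using p_ge[OF S0, of f] by simp
  have p_add: "p (f + g) \<le> p f + p g" for f g
  proof (rule p_le)
    fix z assume "z \<in> S"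
    then show "norm (blinfun_apply (f + g) z) \<le> p f + p g"
      using p_ge[of z f] p_ge[of z g] norm_triangle_ineq[of "blinfun_apply f z" "blinfun_apply g z"] by (simp add: blinfun.add_left)
  qed
  have p_scale_le: "p (scale_blinfun c f) \<le> norm c * p f" for c f
    by (rule p_le) (simp add: norm_mult mult_left_mono p_ge)
  have p_scale: "p (scale_blinfun c f) = norm c * p f" for c f
  proof (cases "c = 0")
    case True
    then show ?thesis using p_scale_le[of 0 f] p_pos[of "scale_blinfun 0 f"] by simp
  next
    case False
    then have "norm c * p f = norm c * p (scale_blinfun (inverse c) (scale_blinfun c f))"
      by simp
    also have "\<dots> \<le> norm c * (norm (inverse c) * p (scale_blinfun c f))"
      by (intro mult_left_mono p_scale_le) simp
    also have "\<dots> = p (scale_blinfun c f)" using False by (simp add: norm_inverse)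
    finally show ?thesis using p_scale_le[of c f] by simp
  qed
  \<comment> \<open>The vectors that almost norm \<open>g\<close> lie in \<open>D\<close>, so
    restricting \<open>g\<close> to \<open>Z\<close> loses no norm.\<close>
  have norm_le_p_G: "norm g \<le> p g" if g: "g \<in> G" for g
  proof (rule field_le_epsilon)
    fix e :: real assume "0 < e"
    then obtain x where "x \<in> D" "norm x \<le> 1" "norm g - e \<le> norm (blinfun_apply g x)"
      using DG[OF g] by blast
    then show "norm g \<le> p g + e" using p_ge[of x g] DZ by (force simp: S_def)
  qed
  have norm_le_p: "norm f \<le> p f" if "f \<in> closure G" for f
  proof (rule field_le_epsilon)
    fix e :: real assume "0 < e"
    then have "0 < e / 2" by simp
    then have "\<exists>g\<in>G. dist g f < e / 2"
      using that unfolding closure_approachable by (elim allE impE)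
    then obtain g where g: "g \<in> G" "dist g f < e / 2" by blast
    have "norm f \<le> norm g + dist g f" by (simp add: dist_norm norm_minus_commute norm_triangle_sub)
    also have "norm g \<le> p g" by (rule norm_le_p_G[OF g(1)])
    also have "p g \<le> p f + norm (g - f)" using p_add[of f "g - f"] p_norm[of "g - f"] by simp
    finally show "norm f \<le> p f + e" using g(2) by (simp add: dist_norm)
  qed
  have ex: "\<exists>z\<in>Z. \<forall>g\<in>G. blinfun_apply g (x - z) = 0" for x
  proof -
    obtain \<Phi> :: "('a \<Rightarrow>\<^sub>L 'k) \<Rightarrow> 'k"
      where \<Phi>: "\<And>f g. \<Phi> (f + g) = \<Phi> f + \<Phi> g" "\<And>c f. \<Phi> (scale_blinfun c f) = c * \<Phi> f"
        "\<And>f. norm (\<Phi> f) \<le> norm x * p f" and \<Phi>G: "\<And>f. f \<in> closure G \<Longrightarrow> \<Phi> f = blinfun_apply f x"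
    proof (rule hahn_banach[OF dual.vector_space_axioms dual.scale_of_real _ _ G(1),
          of "\<lambda>f. norm x * p f" "\<lambda>f. blinfun_apply f x"])
      show "norm (blinfun_apply f x) \<le> norm x * p f" if "f \<in> closure G" for f
      proof -
        have "norm (blinfun_apply f x) \<le> norm f * norm x" by (rule norm_blinfun)
        also have "\<dots> \<le> p f * norm x" by (intro mult_right_mono norm_le_p that) simp
        finally show ?thesis by (simp add: mult.commute)
      qed
      show "norm x * p (f + g) \<le> norm x * p f + norm x * p g" for f g
        using p_add[of f g] by (simp add: mult_left_mono flip: distrib_left)
    qed (simp_all add: blinfun.add_left p_scale, blast)
    have "(\<lambda>f. \<Phi> (Blinfun f)) \<in> bidual_space sc"
      unfolding bidual_space_def
    proof (intro CollectI conjI ballI allI exI)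
      fix f g assume f: "f \<in> dual_space sc" and g: "g \<in> dual_space sc"
      note bl = dual_space_bounded_linear[OF f] dual_space_bounded_linear[OF g]
      have "Blinfun (\<lambda>x. f x + g x) = Blinfun f + Blinfun g"
        using bl by (intro blinfun_eqI)
          (simp add: blinfun.add_left bounded_linear_Blinfun_apply bounded_linear_add)
      then show "\<Phi> (Blinfun (\<lambda>x. f x + g x)) = \<Phi> (Blinfun f) + \<Phi> (Blinfun g)"
        by (simp add: \<Phi>(1))
    next
      fix c f assume f: "f \<in> dual_space sc"
      note bl = dual_space_bounded_linear[OF f]
      have "Blinfun (\<lambda>x. c * f x) = scale_blinfun c (Blinfun f)"
        using bl by (intro blinfun_eqI)
          (simp add: bounded_linear_Blinfun_apply bounded_linear_const_mult)
      then show "\<Phi> (Blinfun (\<lambda>x. c * f x)) = c * \<Phi> (Blinfun f)" by (simp add: \<Phi>(2))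
    next
      fix f assume f: "f \<in> dual_space sc"
      have "norm (\<Phi> (Blinfun f)) \<le> norm x * norm (Blinfun f)"
        using \<Phi>(3)[of "Blinfun f"] p_norm[of "Blinfun f"]
        by (meson mult_left_mono norm_ge_zero order_trans)
      then show "norm (\<Phi> (Blinfun f)) \<le> norm x * onorm f"
        by (simp add: dual_space_Blinfun[OF f])
    qed
    from reflexive[unfolded reflexive_space_def, rule_format, OF this]
    obtain z where z: "\<And>f. f \<in> dual_space sc \<Longrightarrow> \<Phi> (Blinfun f) = f z" by auto
    \<comment> \<open>A functional that vanishes on \<open>Z\<close> has \<open>p\<close> equal to
      zero, so \<Phi> vanishes on it; hence no functional can separate \<open>z\<close> from
      \<open>Z\<close>.\<close>
    have "z \<in> Z"
    proof (rule ccontr)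
      assume "z \<notin> Z"
      then obtain f where f: "f \<in> dual_space sc" "\<And>y. y \<in> Z \<Longrightarrow> f y = 0" "f z \<noteq> 0"
        using separating_functional[OF Z] by blast
      have "p (Blinfun f) \<le> 0"
        by (rule p_le) (simp add: dual_space_Blinfun(1)[OF f(1)] f(2) S_def)
      then have "norm (\<Phi> (Blinfun f)) \<le> 0"
        using \<Phi>(3)[of "Blinfun f"] p_pos[of "Blinfun f"] by simp
      then show False using z[OF f(1)] f(3) by simp
    qed
    moreover have "blinfun_apply g (x - z) = 0" if g: "g \<in> G" for g
    proof -
      have "blinfun_apply g x = \<Phi> g" using \<Phi>G[OF subsetD[OF closure_subset g]] by simp
      also have "\<Phi> g = blinfun_apply g z" using z[OF G(2)[OF g]] by (simp add: blinfun_apply_inverse)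
      finally show ?thesis by (simp add: blinfun.diff_right)
    qed
    ultimately show ?thesis by blast
  qed
  then obtain P where P: "\<And>x. P x \<in> Z" "\<And>x g. g \<in> G \<Longrightarrow> blinfun_apply g (x - P x) = 0"
    by metis
  \<comment> \<open>\<open>P x - z\<close> lies in \<open>Z\<close> and is annihilated by
    \<open>G\<close>, so \<open>norm_le\<close> forces it to be zero. Additivity and homogeneity of
    \<open>P\<close> follow from this uniqueness.\<close>
  have uniq: "P x = z" if z: "z \<in> Z" "\<And>g. g \<in> G \<Longrightarrow> blinfun_apply g (x - z) = 0" for x z
  proof -
    have "norm (P x - z) \<le> norm (P x - z + (z - P x))"
    proof (rule norm_le)
      show "P x - z \<in> Z" by (intro subspace_diff[OF Z(1)] P(1) z(1))
      show "blinfun_apply g (z - P x) = 0" if "g \<in> G" for g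
        using P(2)[OF that, of x] z(2)[OF that] by (simp add: blinfun.diff_right)
    qed
    then show ?thesis by simp
  qed
  have Pnorm: "norm (P x) \<le> norm x" for x
    using norm_le[OF P, of x x] by simp
  have Padd: "P (x + y) = P x + P y" for x y
    using P(2)[of _ x] P(2)[of _ y]
    by (intro uniq subspace_add[OF Z(1)] P(1)) (simp add: blinfun.bilinear_simps)
  have Pscale: "P (sc c x) = sc c (P x)" for c x
  proof (intro uniq subspace_scale[OF Z(1)] P(1))
    fix g assume g: "g \<in> G"
    show "blinfun_apply g (sc c x - sc c (P x)) = 0"
      using P(2)[OF g, of x] dual_space_scale[OF G(2)[OF g], of c "x - P x"]
      by (simp flip: scale_right_diff_distrib)
  qed
  have "bounded_linear P"
    using Pscale[of "of_real r" for r] Pnorm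
    by (intro bounded_linear_intro[where K = 1]) (simp_all add: Padd scale_of_real)
  moreover have PZ: "P z = z" if "z \<in> Z" for z
    using that by (intro uniq) simp_all
  moreover have "range P = Z" using P(1) PZ by (metis (no_types) image_subset_iff rangeI subsetI subset_antisym)
  ultimately show thesis
    using that[of D P] D Pnorm Pscale by (simp add: Z_def bounded_linear_over_def)
qed

end

subsection \<open>Approximate transitivity of operators\<close>

text \<open>Demanding all large exponents, not just a subsequence as in \<open>J_set\<close>, makes
  the relation additive: two instances share a common exponent.\<close>

definition mixes_to :: "('a::real_normed_vector \<Rightarrow> 'a) \<Rightarrow> 'a \<Rightarrow> 'a \<Rightarrow> bool"
  where "mixes_to T x y \<longleftrightarrow>
    (\<forall>e>0. \<forall>\<^sub>F n in sequentially. \<exists>u. dist u x < e \<and> dist ((T ^^ n) u) y < e)"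

lemma mixes_toD:
  "mixes_to T x y \<Longrightarrow> 0 < e \<Longrightarrow> \<forall>\<^sub>F n in sequentially. \<exists>u. dist u x < e \<and> dist ((T ^^ n) u) y < e"
  by (simp add: mixes_to_def)

lemma mixes_to_sequence:
  assumes "xs \<longlonglongrightarrow> x" "(\<lambda>n. (T ^^ n) (xs n)) \<longlonglongrightarrow> y"
  shows "mixes_to T x y"
  unfolding mixes_to_def
proof (intro allI impI)
  fix e :: real assume "0 < e"
  then have "\<forall>\<^sub>F n in sequentially. dist (xs n) x < e \<and> dist ((T ^^ n) (xs n)) y < e"
    using assms by (intro eventually_conj tendstoD)
  then show "\<forall>\<^sub>F n in sequentially. \<exists>u. dist u x < e \<and> dist ((T ^^ n) u) y < e"
    by (rule eventually_mono) blast
qed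

text \<open>Exponents are chosen recursively, each larger than the last and good for the tolerance
  \<open>1 / (m + 1)\<close>.\<close>

lemma mixes_to_J_set:
  assumes "mixes_to T x y"
  shows "y \<in> J_set T x"
proof -
  define Q where "Q m n \<longleftrightarrow> (\<exists>u. dist u x < inverse (real (Suc m)) \<and>
    dist ((T ^^ n) u) y < inverse (real (Suc m)))" for m n
  have ev: "\<exists>N. \<forall>n\<ge>N. Q m n" for m
    using mixes_toD[OF assms, of "inverse (real (Suc m))"]
    by (simp add: Q_def eventually_sequentially)
  have "\<exists>k. \<forall>m. Q m (k m) \<and> k m < k (Suc m)"
  proof (rule dependent_nat_choice)
    show "\<exists>n. Q 0 n" using ev by blast
    fix n m
    obtain N where "\<forall>j\<ge>N. Q (Suc m) j" using ev by blast
    then have "Q (Suc m) (max N (Suc n)) \<and> n < max N (Suc n)" by simp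
    then show "\<exists>j. Q (Suc m) j \<and> n < j" by blast
  qed
  then obtain k where k: "\<And>m. Q m (k m)" "\<And>m. k m < k (Suc m)" by blast
  have "\<forall>m. \<exists>u. dist u x < inverse (real (Suc m)) \<and> dist ((T ^^ k m) u) y < inverse (real (Suc m))"
    using k(1) by (simp add: Q_def)
  then obtain xs where xs: "\<And>m. dist (xs m) x < inverse (real (Suc m))"
    "\<And>m. dist ((T ^^ k m) (xs m)) y < inverse (real (Suc m))"
    by metis
  have "xs \<longlonglongrightarrow> x" "(\<lambda>m. (T ^^ k m) (xs m)) \<longlonglongrightarrow> y"
    unfolding tendsto_dist_iff[of xs] tendsto_dist_iff[of "\<lambda>m. (T ^^ k m) (xs m)"]
    by (rule real_tendsto_sandwich[OF _ _ tendsto_const LIMSEQ_inverse_real_of_nat];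
        simp add: less_imp_le xs del: of_nat_Suc)+
  moreover have "strict_mono k" using k(2) by (simp add: strict_mono_Suc_iff)
  ultimately show ?thesis by (auto simp: J_set_def)
qed

lemma mixes_to_approx:
  assumes "\<And>e. 0 < e \<Longrightarrow> \<exists>x' y'. dist x' x < e \<and> dist y' y < e \<and> mixes_to T x' y'"
  shows "mixes_to T x y"
  unfolding mixes_to_def
proof (intro allI impI)
  fix e :: real assume "0 < e"
  then have e: "0 < e / 2" by simp
  obtain x' y' where x': "dist x' x < e / 2" "dist y' y < e / 2" "mixes_to T x' y'"
    using assms[OF e] by blast
  show "\<forall>\<^sub>F n in sequentially. \<exists>u. dist u x < e \<and> dist ((T ^^ n) u) y < e"
    using mixes_toD[OF x'(3) e]
  proof (rule eventually_mono)
    fix n assume "\<exists>u. dist u x' < e / 2 \<and> dist ((T ^^ n) u) y' < e / 2"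
    then obtain u where u: "dist u x' < e / 2" "dist ((T ^^ n) u) y' < e / 2" by blast
    have "dist u x < e" by (rule dist_triangle_half_l[of _ x']) (use u x' in \<open>simp_all add: dist_commute\<close>)
    moreover have "dist ((T ^^ n) u) y < e"
      by (rule dist_triangle_half_l[of _ y']) (use u x' in \<open>simp_all add: dist_commute\<close>)
    ultimately show "\<exists>u. dist u x < e \<and> dist ((T ^^ n) u) y < e" by blast
  qed
qed

lemma linear_funpow:
  fixes T :: "'a::real_vector \<Rightarrow> 'a"
  shows "linear T \<Longrightarrow> linear (T ^^ n)"
  by (induction n) (simp_all add: linear_iff)

lemma mixes_to_add:
  assumes T: "linear T" and xy: "mixes_to T x y" "mixes_to T x' y'"
  shows "mixes_to T (x + x') (y + y')"
  unfolding mixes_to_def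
proof (intro allI impI)
  fix e :: real assume "0 < e"
  then have e: "0 < e / 2" by simp
  show "\<forall>\<^sub>F n in sequentially. \<exists>u. dist u (x + x') < e \<and> dist ((T ^^ n) u) (y + y') < e"
    using eventually_conj[OF mixes_toD[OF xy(1) e] mixes_toD[OF xy(2) e]]
  proof (rule eventually_mono, elim conjE exE)
    fix n u v
    assume *: "dist u x < e / 2" "dist ((T ^^ n) u) y < e / 2"
      "dist v x' < e / 2" "dist ((T ^^ n) v) y' < e / 2"
    have "dist (u + v) (x + x') < e"
      using dist_triangle_add[of u v x x'] * by linarith
    moreover have "dist ((T ^^ n) (u + v)) (y + y') < e"
      using dist_triangle_add[of "(T ^^ n) u" "(T ^^ n) v" y y'] *
      by (simp add: linear_add[OF linear_funpow[OF T]])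
    ultimately show "\<exists>u. dist u (x + x') < e \<and> dist ((T ^^ n) u) (y + y') < e" by blast
  qed
qed

lemma mixes_to_zero: "linear T \<Longrightarrow> mixes_to T 0 0"
  by (rule mixes_to_sequence[of "\<lambda>_. 0"]) (simp_all add: linear_0 linear_funpow)

context normed_space_over
begin

lemma mixes_to_scale:
  assumes T: "\<And>c x. T (sc c x) = sc c (T x)" and "linear T" and xy: "mixes_to T x y"
  shows "mixes_to T (sc c x) (sc c y)"
proof (cases "c = 0")
  case True
  then show ?thesis using mixes_to_zero[OF assms(2)] by simp
next
  case False
  have Tn: "(T ^^ n) (sc c u) = sc c ((T ^^ n) u)" for n u
    by (induction n) (simp_all add: T)
  have dist: "dist (sc c u) (sc c v) = norm c * dist u v" for u v
    by (simp add: dist_norm norm_scale flip: scale_right_diff_distrib)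
  show ?thesis
    unfolding mixes_to_def
  proof (intro allI impI)
    fix e :: real assume "0 < e"
    then have e: "0 < e / norm c" using False by simp
    show "\<forall>\<^sub>F n in sequentially. \<exists>u. dist u (sc c x) < e \<and> dist ((T ^^ n) u) (sc c y) < e"
      using mixes_toD[OF xy e]
    proof (rule eventually_mono, elim exE conjE)
      fix n u assume "dist u x < e / norm c" "dist ((T ^^ n) u) y < e / norm c"
      then have "dist (sc c u) (sc c x) < e" "dist ((T ^^ n) (sc c u)) (sc c y) < e"
        using False by (simp_all add: dist Tn field_simps)
      then show "\<exists>u. dist u (sc c x) < e \<and> dist ((T ^^ n) u) (sc c y) < e" by blast
    qed
  qed
qed

text \<open>For an operator linear over \<open>sc\<close>, the vectors that mix to 0, and those to
  which 0 mixes, form subspaces; \<open>mixes_to_approx\<close> adds their limits.\<close>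

lemma mixes_to_closure_span:
  assumes T: "\<And>c x. T (sc c x) = sc c (T x)" "linear T"
  shows "(\<And>a. a \<in> A \<Longrightarrow> mixes_to T a 0) \<Longrightarrow> x \<in> closure (span A) \<Longrightarrow> mixes_to T x 0"
    and "(\<And>a. a \<in> A \<Longrightarrow> mixes_to T 0 a) \<Longrightarrow> x \<in> closure (span A) \<Longrightarrow> mixes_to T 0 x"
proof -
  have sub: "subspace {x. mixes_to T x 0}" "subspace {x. mixes_to T 0 x}"
    using mixes_to_zero[OF T(2)] mixes_to_add[OF T(2), of _ 0 _ 0] mixes_to_add[OF T(2), of 0 _ 0]
      mixes_to_scale[OF T, of _ 0] mixes_to_scale[OF T, of 0]
    by (auto simp: subspace_def)
  show "mixes_to T x 0" if A: "\<And>a. a \<in> A \<Longrightarrow> mixes_to T a 0" and x: "x \<in> closure (span A)"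
  proof (rule mixes_to_approx)
    fix e :: real assume e: "0 < e"
    then obtain x' where "x' \<in> span A" "dist x' x < e"
      using x by (auto simp: closure_approachable)
    moreover have "span A \<subseteq> {x. mixes_to T x 0}" using A by (intro span_minimal sub) auto
    ultimately show "\<exists>x' y'. dist x' x < e \<and> dist y' 0 < e \<and> mixes_to T x' y'"
      using e by (intro exI[of _ x'] exI[of _ 0]) auto
  qed
  show "mixes_to T 0 x" if A: "\<And>a. a \<in> A \<Longrightarrow> mixes_to T 0 a" and x: "x \<in> closure (span A)"
  proof (rule mixes_to_approx)
    fix e :: real assume e: "0 < e"
    then obtain x' where "x' \<in> span A" "dist x' x < e"
      using x by (auto simp: closure_approachable)
    moreover have "span A \<subseteq> {x. mixes_to T 0 x}" using A by (intro span_minimal sub) auto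
    ultimately show "\<exists>x' y'. dist x' 0 < e \<and> dist y' x < e \<and> mixes_to T x' y'"
      using e by (intro exI[of _ 0] exI[of _ x']) auto
  qed
qed

end

section \<open>Exponential of the backward shift and Pade approximation\<close>

text \<open>Multiplied by \<open>fact l\<close>, the sum is a polynomial of degree \<open>k\<close> in \<open>l\<close> expanded in
  binomial coefficients, namely a multiple of \<open>(l - k - 2) gchoose k\<close>.\<close>

lemma exponential_pade_coefficients:
  obtains r :: "nat \<Rightarrow> real" where "\<And>i. k < i \<Longrightarrow> r i = 0"
    "(\<Sum>i\<le>k + 1. r i / fact (k + 1 - i)) = 1"
    "\<And>l. k + 1 < l \<Longrightarrow> l \<le> 2 * k + 1 \<Longrightarrow> (\<Sum>i\<le>l. r i / fact (l - i)) = 0"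
proof -
  \<comment> \<open>With this \<open>a\<close>, \<open>l + a\<close> equals -1 at
    \<open>l = k + 1\<close>, where \<open>c\<close> normalises the sum to 1, and runs through 0,
    ..., \<open>k - 1\<close> for the next \<open>k\<close> values of \<open>l\<close>, where the
    binomial coefficient vanishes.\<close>
  define a where "a = - real k - 2"
  define c where "c = fact (k + 1) * (-1 :: real) ^ k"
  define r where "r i = (if i \<le> k then c * (a gchoose (k - i)) / fact i else 0)" for i
  have sum: "(\<Sum>i\<le>l. r i / fact (l - i)) = c / fact l * ((real l + a) gchoose k)" if "k \<le> l" for l
  proof -
    have "(\<Sum>i\<le>l. r i / fact (l - i)) = (\<Sum>i\<in>{0..k}. r i / fact (l - i))"
      using that by (intro sum.mono_neutral_right) (auto simp: r_def)
    also have "\<dots> = (\<Sum>i\<in>{0..k}. c / fact l * ((real l gchoose i) * (a gchoose (k - i))))"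
    proof (rule sum.cong)
      fix i assume "i \<in> {0..k}"
      then show "r i / fact (l - i) = c / fact l * ((real l gchoose i) * (a gchoose (k - i)))"
        using that by (simp add: r_def binomial_fact flip: binomial_gbinomial)
    qed simp
    also have "\<dots> = c / fact l * ((real l + a) gchoose k)"
      by (simp only: sum_distrib_left[symmetric] gbinomial_Vandermonde)
    finally show ?thesis .
  qed
  show thesis
  proof (rule that[of r])
    have "((-1 :: real) gchoose k) = (-1) ^ k"
      using gbinomial_minus[of 1 k] by (simp add: gbinomial_of_nat_symmetric)
    then show "(\<Sum>i\<le>k + 1. r i / fact (k + 1 - i)) = 1"
      using sum[of "k + 1"] by (simp add: a_def c_def flip: power_mult_distrib)
  next
    fix l assume l: "k + 1 < l" "l \<le> 2 * k + 1"
    then have "real l + a = real (l - k - 2)" by (simp add: a_def)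
    moreover have "l - k - 2 < k" using l by linarith
    ultimately have "(real l + a) gchoose k = 0"
      by (simp flip: binomial_gbinomial)
    then show "(\<Sum>i\<le>l. r i / fact (l - i)) = 0" using sum[of l] l by simp
  qed (simp add: r_def)
qed

text \<open>On the span of the \<open>g n\<close> the operator is the exponential of the shift \<open>g n \<mapsto> g (n - 1)\<close>.\<close>

lemma mixes_to_exponential_shift:
  fixes T :: "'a::real_normed_vector \<Rightarrow> 'a" and g :: "nat \<Rightarrow> 'a"
  assumes T: "linear T"
    and Tg: "\<And>n. T (g n) = (\<Sum>i\<le>n. (1 / fact i) *\<^sub>R g (n - i))"
  shows "mixes_to T 0 (g k)" "mixes_to T (g k) 0"
proof -
  \<comment> \<open>\<open>U t n\<close> is exp(tS) applied to \<open>g n\<close>, where S is the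
    backward shift killing \<open>g 0\<close>. On these vectors \<open>T\<close> is exp(S), so it
    advances \<open>t\<close> by 1.\<close>
  define U where "U t n = (\<Sum>i\<le>n. (t ^ i / fact i) *\<^sub>R g (n - i))" for t :: real and n
  \<comment> \<open>Grouping by the total shift \<open>l = i + j\<close> gives the Cauchy product of
    the coefficients, that is, the composition of two power series in S.\<close>
  have reindex: "(\<Sum>i\<le>n. a i *\<^sub>R (\<Sum>j\<le>n - i. b j *\<^sub>R g (n - i - j)))
      = (\<Sum>l\<le>n. (\<Sum>i\<le>l. a i * b (l - i)) *\<^sub>R g (n - l))" for a b n
  proof -
    have "(\<Sum>i\<le>n. a i *\<^sub>R (\<Sum>j\<le>n - i. b j *\<^sub>R g (n - i - j)))
        = (\<Sum>i\<le>n. \<Sum>j\<le>n - i. (a i * b j) *\<^sub>R g (n - (i + j)))"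
      by (simp add: scaleR_sum_right)
    also have "\<dots> = (\<Sum>(i, j)\<in>{(i, j). i + j \<le> n}. (a i * b j) *\<^sub>R g (n - (i + j)))"
      by (subst sum.Sigma) (auto intro!: sum.cong)
    also have "\<dots> = (\<Sum>l\<le>n. \<Sum>i\<le>l. (a i * b (l - i)) *\<^sub>R g (n - (i + (l - i))))"
      by (rule sum.triangle_reindex_eq)
    also have "\<dots> = (\<Sum>l\<le>n. (\<Sum>i\<le>l. a i * b (l - i)) *\<^sub>R g (n - l))"
      by (simp add: scaleR_sum_left)
    finally show ?thesis .
  qed
  have TU: "T (U t n) = U (t + 1) n" for t n
  proof -
    have exp_sum: "(\<Sum>i\<le>l. t ^ i / fact i * (1 / fact (l - i))) = (t + 1) ^ l / fact l" for l
      using exp_series_add_commuting[of t 1 l] by (simp add: divide_inverse mult_ac)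
    have "T (U t n) = (\<Sum>i\<le>n. (t ^ i / fact i) *\<^sub>R (\<Sum>j\<le>n - i. (1 / fact j) *\<^sub>R g (n - i - j)))"
      by (simp add: U_def linear_sum[OF T] linear_scale[OF T] Tg)
    also have "\<dots> = (\<Sum>l\<le>n. (\<Sum>i\<le>l. t ^ i / fact i * (1 / fact (l - i))) *\<^sub>R g (n - l))"
      by (rule reindex)
    also have "\<dots> = U (t + 1) n" by (simp only: exp_sum U_def)
    finally show ?thesis .
  qed
  have TnU: "(T ^^ m) (U t n) = U (t + real m) n" for m t n
    by (induction m) (simp_all add: TU algebra_simps)
  obtain r :: "nat \<Rightarrow> real" where r: "\<And>i. k < i \<Longrightarrow> r i = 0"
    "(\<Sum>i\<le>k + 1. r i / fact (k + 1 - i)) = 1"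
    "\<And>l. k + 1 < l \<Longrightarrow> l \<le> 2 * k + 1 \<Longrightarrow> (\<Sum>i\<le>l. r i / fact (l - i)) = 0"
    using exponential_pade_coefficients[of k] by blast
  \<comment> \<open>With the polynomial r having coefficients \<open>r i\<close>,
    \<open>W s t\<close> is t^(-k-1) r(tS) exp(sS) applied to \<open>g (2 * k + 1)\<close>. As r has
    degree at most \<open>k\<close>, \<open>W 0 t\<close> tends to 0 for large \<open>t\<close>. In
    \<open>W t t\<close> the Pade conditions kill all shifts beyond \<open>k + 1\<close>, the shift
    by \<open>k + 1\<close> leaves exactly \<open>g k\<close>, and smaller shifts carry negative
    powers of \<open>t\<close>. The index \<open>2 * k + 1\<close> ends the expansion where those
    conditions end.\<close>
  define W where "W s t = (\<Sum>i\<le>2 * k + 1. (r i * t ^ i / t ^ (k + 1)) *\<^sub>R U s (2 * k + 1 - i))" for s t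
  have TnW: "(T ^^ m) (W s t) = W (s + real m) t" for m s t
    by (simp only: W_def linear_sum[OF linear_funpow[OF T]] linear_scale[OF linear_funpow[OF T]] TnU)
  have quot: "(\<lambda>n. t n ^ l / t n ^ (k + 1)) \<longlonglongrightarrow> 0"
    if t: "(\<lambda>n. inverse (t n)) \<longlonglongrightarrow> 0" and l: "l \<le> k" for t :: "nat \<Rightarrow> real" and l
  proof -
    have "x ^ l / x ^ (k + 1) = inverse x ^ (k + 1 - l)" for x :: real
      using l by (cases "x = 0") (simp_all add: power_diff field_simps power_0_left)
    moreover have "(\<lambda>n. inverse (t n) ^ (k + 1 - l)) \<longlonglongrightarrow> 0"
      using tendsto_power[OF t, of "k + 1 - l"] l by (simp add: power_0_left)
    ultimately show ?thesis by simp
  qed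
  have W0: "(\<lambda>n. W 0 (t n)) \<longlonglongrightarrow> 0" if t: "(\<lambda>n. inverse (t n)) \<longlonglongrightarrow> 0" for t
  proof -
    have "(\<lambda>n. (r i * t n ^ i / t n ^ (k + 1)) *\<^sub>R U 0 (2 * k + 1 - i)) \<longlonglongrightarrow> 0" for i
    proof (cases "i \<le> k")
      case True
      then have "(\<lambda>n. (r i * (t n ^ i / t n ^ (k + 1))) *\<^sub>R U 0 (2 * k + 1 - i))
          \<longlonglongrightarrow> (r i * 0) *\<^sub>R U 0 (2 * k + 1 - i)"
        by (intro tendsto_intros quot[OF t])
      then show ?thesis by simp
    qed (simp add: r(1))
    then show ?thesis unfolding W_def by (rule tendsto_null_sum)
  qed
  have Wt: "(\<lambda>n. W (t n) (t n)) \<longlonglongrightarrow> g k"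
    if t: "(\<lambda>n. inverse (t n)) \<longlonglongrightarrow> 0" and nz: "\<forall>\<^sub>F n in sequentially. t n \<noteq> 0" for t
  proof -
    define s where "s l = (\<Sum>i\<le>l. r i / fact (l - i))" for l
    have "W x x = (\<Sum>l\<le>k. (s l * (x ^ l / x ^ (k + 1))) *\<^sub>R g (2 * k + 1 - l)) + g k"
      if x: "x \<noteq> 0" for x
    proof -
      have coeff: "(\<Sum>i\<le>l. r i * x ^ i / x ^ (k + 1) * (x ^ (l - i) / fact (l - i)))
          = s l * (x ^ l / x ^ (k + 1))" for l
      proof -
        have "r i * x ^ i / x ^ (k + 1) * (x ^ (l - i) / fact (l - i))
            = r i / fact (l - i) * (x ^ l / x ^ (k + 1))" if "i \<le> l" for i
          using that power_add[of x i "l - i"] by (simp add: mult_ac)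
        then show ?thesis unfolding s_def sum_distrib_right by (intro sum.cong refl) simp_all
      qed
      have "W x x = (\<Sum>l\<le>2 * k + 1. (\<Sum>i\<le>l. r i * x ^ i / x ^ (k + 1) * (x ^ (l - i) / fact (l - i)))
          *\<^sub>R g (2 * k + 1 - l))"
        unfolding W_def U_def by (rule reindex)
      also have "\<dots> = (\<Sum>l\<le>2 * k + 1. (s l * (x ^ l / x ^ (k + 1))) *\<^sub>R g (2 * k + 1 - l))"
        by (simp only: coeff)
      also have "\<dots> = (\<Sum>l\<le>k + 1. (s l * (x ^ l / x ^ (k + 1))) *\<^sub>R g (2 * k + 1 - l))"
        using r(3) by (intro sum.mono_neutral_right) (auto simp: s_def)
      also have "\<dots> = (\<Sum>l\<le>k. (s l * (x ^ l / x ^ (k + 1))) *\<^sub>R g (2 * k + 1 - l)) + g k"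
        using x r(2) by (simp add: s_def)
      finally show ?thesis .
    qed
    then have "\<forall>\<^sub>F n in sequentially.
        (\<Sum>l\<le>k. (s l * (t n ^ l / t n ^ (k + 1))) *\<^sub>R g (2 * k + 1 - l)) + g k = W (t n) (t n)"
      using nz by (simp add: eventually_mono)
    moreover have "(\<lambda>n. (\<Sum>l\<le>k. (s l * (t n ^ l / t n ^ (k + 1))) *\<^sub>R g (2 * k + 1 - l)) + g k)
        \<longlonglongrightarrow> (\<Sum>l\<le>k. (s l * 0) *\<^sub>R g (2 * k + 1 - l)) + g k"
      by (intro tendsto_intros quot[OF t]) simp
    ultimately have "(\<lambda>n. W (t n) (t n)) \<longlonglongrightarrow> (\<Sum>l\<le>k. (s l * 0) *\<^sub>R g (2 * k + 1 - l)) + g k"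
      by (rule Lim_transform_eventually[rotated])
    then show ?thesis by simp
  qed
  \<comment> \<open>Taking \<open>t = n\<close> leads from near 0 to near \<open>g k\<close>; taking
    \<open>t = - n\<close>, with start \<open>W (- n) (- n)\<close>, leads from near
    \<open>g k\<close> to near 0.\<close>
  have inv: "(\<lambda>n. inverse (real n)) \<longlonglongrightarrow> 0" "(\<lambda>n. inverse (- real n)) \<longlonglongrightarrow> 0"
    using lim_inverse_n tendsto_minus[OF lim_inverse_n] by simp_all
  have nz: "\<forall>\<^sub>F n in sequentially. real n \<noteq> 0" "\<forall>\<^sub>F n in sequentially. - real n \<noteq> 0"
    using eventually_gt_at_top[of 0] by (auto elim: eventually_mono)
  show "mixes_to T 0 (g k)"
    by (rule mixes_to_sequence[OF W0[OF inv(1)]]) (simp add: TnW Wt[OF inv(1) nz(1)])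
  show "mixes_to T (g k) 0"
    by (rule mixes_to_sequence[OF Wt[OF inv(2) nz(2)]]) (simp add: TnW W0[OF inv(2)])
qed

subsection \<open>Weighted biorthogonal sequences\<close>

context normed_space_over
begin

lemma dual_space_sum:
  assumes "finite I" "\<And>i. i \<in> I \<Longrightarrow> f i \<in> dual_space sc"
  shows "(\<lambda>x. \<Sum>i\<in>I. f i x) \<in> dual_space sc"
  using assms by (auto simp: dual_space_def bounded_linear_over_def sum_distrib_left
      intro!: bounded_linear_sum)

lemma dual_space_diff:
  "f \<in> dual_space sc \<Longrightarrow> g \<in> dual_space sc \<Longrightarrow> (\<lambda>x. f x - g x) \<in> dual_space sc"
  by (auto simp: dual_space_def bounded_linear_over_def algebra_simps intro!: bounded_linear_sub)

lemma dual_space_mult: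
  "f \<in> dual_space sc \<Longrightarrow> (\<lambda>x. c * f x) \<in> dual_space sc"
  by (auto simp: dual_space_def bounded_linear_over_def algebra_simps
      intro!: bounded_linear_const_mult)

lemma dual_space_sum_scale:
  assumes f: "f \<in> dual_space sc"
  shows "f (\<Sum>i\<in>I. sc (c i) (x i)) = (\<Sum>i\<in>I. c i * f (x i))"
  by (simp add: Real_Vector_Spaces.linear_sum[OF bounded_linear.linear[OF dual_space_bounded_linear[OF f]]]
      dual_space_scale[OF f])

end

section \<open>Inductive choice of vectors and coordinate functionals\<close>

context rc_space
begin

text \<open>One Gram-Schmidt step: \<open>b n\<close> loses its components along the earlier
  vectors, and a functional equal to 1 on the remainder is corrected to vanish on them. Replacing
  \<open>(x, f)\<close> by \<open>(a x, f / a)\<close> keeps \<open>f x = 1\<close> and makes the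
  norm of \<open>f\<close> as small as \<open>v\<close> requires.\<close>

lemma biorthogonal_step:
  fixes b :: "nat \<Rightarrow> 'a" and h :: "nat \<Rightarrow> 'a \<times> ('a \<Rightarrow> 'k)"
  assumes b: "independent (range b)" "inj b" and e: "0 < e"
    and dual: "\<And>i. i < n \<Longrightarrow> snd (h i) \<in> dual_space sc"
    and biorth: "\<And>i j. i < n \<Longrightarrow> j < n \<Longrightarrow> snd (h i) (fst (h j)) = (if i = j then 1 else 0)"
    and span: "\<And>i. i < n \<Longrightarrow> fst (h i) \<in> span (b ` {..i})"
  obtains x f where "f \<in> dual_space sc" "f x = 1" "\<And>i. i < n \<Longrightarrow> f (fst (h i)) = 0"
    "\<And>i. i < n \<Longrightarrow> snd (h i) x = 0" "x \<in> span (b ` {..n})"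
    "b n \<in> span (insert x ((\<lambda>i. fst (h i)) ` {..<n}))"
    "onorm f * v \<le> e"
proof -
  define y where "y = (\<Sum>i<n. sc (snd (h i) (b n)) (fst (h i)))"
  define x where "x = b n - y"
  have y: "y \<in> span (b ` {..<n})"
  proof -
    have "fst (h i) \<in> span (b ` {..<n})" if "i < n" for i
      using span[OF that] span_mono[of "b ` {..i}" "b ` {..<n}"] that by force
    then show ?thesis unfolding y_def by (intro span_sum span_scale) simp
  qed
  have "x \<noteq> 0"
  proof
    assume "x = 0"
    then have "b n \<in> span (b ` {..<n})" using y by (simp add: x_def)
    moreover have "b ` {..<n} \<subseteq> range b - {b n}" using b(2) by (auto dest: injD)
    ultimately have "b n \<in> span (range b - {b n})" using span_mono by blast
    then show False using b(1) by (auto simp: dependent_def)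
  qed
  have hx: "snd (h i) x = 0" if i: "i < n" for i
  proof -
    have "snd (h i) y = (\<Sum>j<n. snd (h j) (b n) * snd (h i) (fst (h j)))"
      unfolding y_def by (rule dual_space_sum_scale[OF dual[OF i]])
    also have "\<dots> = (\<Sum>j<n. if i = j then snd (h j) (b n) else 0)"
      using biorth[OF i] by (intro sum.cong) auto
    also have "\<dots> = snd (h i) (b n)" using i by simp
    finally show ?thesis
      by (simp add: x_def linear_diff[OF bounded_linear.linear[OF dual_space_bounded_linear[OF dual[OF i]]]])
  qed
  obtain g where g: "g \<in> dual_space sc" "g x = of_real (norm x)"
    using norming_functional[of x] by blast
  define g1 where "g1 z = inverse (of_real (norm x)) * g z" for z
  have g1: "g1 \<in> dual_space sc" "g1 x = 1"
    using dual_space_mult[OF g(1)] \<open>x \<noteq> 0\<close> g(2) by (simp_all add: g1_def[abs_def])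
  define f1 where "f1 z = g1 z - (\<Sum>i<n. g1 (fst (h i)) * snd (h i) z)" for z
  have f1: "f1 \<in> dual_space sc"
    unfolding f1_def[abs_def] using g1(1) dual
    by (intro dual_space_diff dual_space_sum dual_space_mult) auto
  have f1x: "f1 x = 1" by (simp add: f1_def g1 hx)
  have f1h: "f1 (fst (h j)) = 0" if j: "j < n" for j
  proof -
    have "(\<Sum>i<n. g1 (fst (h i)) * snd (h i) (fst (h j))) = (\<Sum>i<n. if i = j then g1 (fst (h i)) else 0)"
      using biorth[OF _ j] by (intro sum.cong) auto
    then show ?thesis using j by (simp add: f1_def)
  qed
  \<comment> \<open>Chosen so that \<open>a\<close> is at least 1 and
    \<open>onorm f1 * \<bar>v\<bar> \<le> e * a\<close>.\<close>
  define a where "a = 1 + onorm f1 * \<bar>v\<bar> / e"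
  have on: "0 \<le> onorm f1" by (rule onorm_pos_le[OF dual_space_bounded_linear[OF f1]])
  then have a: "1 \<le> a" using e by (simp add: a_def)
  define f where "f z = inverse (of_real a) * f1 z" for z
  have f: "f \<in> dual_space sc" unfolding f_def[abs_def] by (rule dual_space_mult[OF f1])
  have "onorm f \<le> onorm f1 / a"
  proof (rule onorm_bound)
    show "norm (f z) \<le> onorm f1 / a * norm z" for z
      using onorm[OF dual_space_bounded_linear[OF f1], of z] a
      by (simp add: f_def norm_mult norm_divide divide_simps mult_ac)
  qed (use on a in simp)
  then have "onorm f * \<bar>v\<bar> \<le> onorm f1 / a * \<bar>v\<bar>"
    by (rule mult_right_mono) simp
  also have "\<dots> \<le> e"
  proof -
    have "onorm f1 * \<bar>v\<bar> \<le> e * a" using e by (simp add: a_def distrib_left)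
    then show ?thesis using a by (simp add: pos_divide_le_eq)
  qed
  finally have v: "onorm f * v \<le> e"
    using mult_left_mono[OF abs_ge_self[of v] onorm_pos_le[OF dual_space_bounded_linear[OF f]]]
    by linarith
  have sp: "b n \<in> span (insert (sc (of_real a) x) ((\<lambda>i. fst (h i)) ` {..<n}))"
  proof -
    have "sc (inverse (of_real a)) (sc (of_real a) x) \<in> span (insert (sc (of_real a) x) ((\<lambda>i. fst (h i)) ` {..<n}))"
      by (intro span_scale span_base) simp
    moreover have "sc (inverse (of_real a)) (sc (of_real a) x) = x" using a by simp
    moreover have "y \<in> span (insert (sc (of_real a) x) ((\<lambda>i. fst (h i)) ` {..<n}))"
      unfolding y_def by (intro span_sum span_scale span_base) auto
    ultimately have "x + y \<in> span (insert (sc (of_real a) x) ((\<lambda>i. fst (h i)) ` {..<n}))"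
      by (metis span_add)
    then show ?thesis by (simp add: x_def)
  qed
  show thesis
  proof (rule that[of f "sc (of_real a) x"])
    show "f (sc (of_real a) x) = 1"
      using a by (simp add: f_def f1x dual_space_scale[OF f1])
    show "snd (h i) (sc (of_real a) x) = 0" if "i < n" for i
      by (simp add: dual_space_scale[OF dual[OF that]] hx[OF that])
    show "sc (of_real a) x \<in> span (b ` {..n})"
    proof (intro span_scale)
      have "b n \<in> span (b ` {..n})" by (intro span_base) simp
      moreover have "y \<in> span (b ` {..n})"
        using y span_mono[of "b ` {..<n}" "b ` {..n}"] by force
      ultimately show "x \<in> span (b ` {..n})" unfolding x_def by (rule span_diff)
    qed
  qed (use f f1h v sp in \<open>simp_all add: f_def[of "fst _"]\<close>)
qed

text \<open>The sum in the last claim starts at \<open>i = 1\<close>, so it involves only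
  \<open>g\<close> below \<open>n\<close> and is known when \<phi>\<open>n\<close> is chosen. The
  bounds add up to \<open>e\<close>.\<close>

theorem weighted_biorthogonal_sequence:
  fixes b :: "nat \<Rightarrow> 'a"
  assumes b: "independent (range b)" "inj b" and e: "0 < e"
  obtains g :: "nat \<Rightarrow> 'a" and \<phi> :: "nat \<Rightarrow> 'a \<Rightarrow> 'k"
  where "\<And>n. \<phi> n \<in> dual_space sc" "\<And>i j. \<phi> i (g j) = (if i = j then 1 else 0)"
    "span (range g) = span (range b)"
    "\<And>n. onorm (\<phi> n) * norm (\<Sum>i\<in>{1..n}. (1 / fact i) *\<^sub>R g (n - i)) \<le> e / 2 ^ Suc n"
proof -
  \<comment> \<open>The condition at \<open>n\<close> involves \<open>h\<close> only below
    \<open>n\<close>, as well-founded recursion requires. The two span clauses make the final spans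
    equal.\<close>
  define P where "P h n p \<longleftrightarrow> (case p of (x, f) \<Rightarrow> f \<in> dual_space sc \<and> f x = 1 \<and>
    (\<forall>i<n. f (fst (h i)) = 0 \<and> snd (h i) x = 0) \<and> x \<in> span (b ` {..n}) \<and>
    b n \<in> span (insert x ((\<lambda>i. fst (h i)) ` {..<n})) \<and>
    onorm f * norm (\<Sum>i\<in>{1..n}. (1 / fact i) *\<^sub>R fst (h (n - i))) \<le> e / 2 ^ Suc n)"
    for h :: "nat \<Rightarrow> 'a \<times> ('a \<Rightarrow> 'k)" and n p
  have biorth: "snd (h i) (fst (h j)) = (if i = j then 1 else 0)"
    if P: "\<And>i. i < n \<Longrightarrow> P h i (h i)" and ij: "i < n" "j < n" for h n i j
    using P[OF ij(1)] P[OF ij(2)]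
    by (cases i j rule: linorder_cases) (auto simp: P_def split: prod.splits)
  have "\<exists>h. \<forall>n. P h n (h n)"
  proof (rule dependent_wf_choice[OF wf_less_than])
    fix f g :: "nat \<Rightarrow> 'a \<times> ('a \<Rightarrow> 'k)" and n p
    assume "\<And>z. (z, n) \<in> less_than \<Longrightarrow> f z = g z"
    then have eq: "\<And>i. i < n \<Longrightarrow> f i = g i" by simp
    have "(\<lambda>i. fst (f i)) ` {..<n} = (\<lambda>i. fst (g i)) ` {..<n}"
      by (intro image_cong) (simp_all add: eq)
    moreover have "(\<Sum>i\<in>{1..n}. (1 / fact i) *\<^sub>R fst (f (n - i))) = (\<Sum>i\<in>{1..n}. (1 / fact i) *\<^sub>R fst (g (n - i)))"
      by (intro sum.cong) (simp_all add: eq)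
    ultimately show "P f n p = P g n p" by (simp add: P_def eq cong: conj_cong)
  next
    fix n h assume "\<And>y. (y, n) \<in> less_than \<Longrightarrow> P h y (h y)"
    then have P: "\<And>i. i < n \<Longrightarrow> P h i (h i)" by simp
    have dual: "snd (h i) \<in> dual_space sc" and span: "fst (h i) \<in> span (b ` {..i})" if "i < n" for i
      using P[OF that] by (auto simp: P_def split: prod.splits)
    have biorth': "snd (h i) (fst (h j)) = (if i = j then 1 else 0)" if "i < n" "j < n" for i j
      by (rule biorth[OF P that])
    have "0 < e / 2 ^ Suc n" using e by simp
    then show "\<exists>p. P h n p"
    proof (rule biorthogonal_step[OF b, where n = n and h = h
          and v = "norm (\<Sum>i\<in>{1..n}. (1 / fact i) *\<^sub>R fst (h (n - i)))"])
      fix x f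
      assume "f \<in> dual_space sc" "f x = 1" "\<And>i. i < n \<Longrightarrow> f (fst (h i)) = 0"
        "\<And>i. i < n \<Longrightarrow> snd (h i) x = 0" "x \<in> span (b ` {..n})"
        "b n \<in> span (insert x ((\<lambda>i. fst (h i)) ` {..<n}))"
        "onorm f * norm (\<Sum>i\<in>{1..n}. (1 / fact i) *\<^sub>R fst (h (n - i))) \<le> e / 2 ^ Suc n"
      then have "P h n (x, f)" by (simp add: P_def)
      then show ?thesis by blast
    qed (fact dual biorth' span)+
  qed
  then obtain h where h: "\<And>n. P h n (h n)" by blast
  show thesis
  proof (rule that[of "\<lambda>n. snd (h n)" "\<lambda>n. fst (h n)"])
    show "snd (h n) \<in> dual_space sc"
      "onorm (snd (h n)) * norm (\<Sum>i\<in>{1..n}. (1 / fact i) *\<^sub>R fst (h (n - i))) \<le> e / 2 ^ Suc n" for n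
      using h[of n] by (auto simp: P_def split: prod.splits)
    show "snd (h i) (fst (h j)) = (if i = j then 1 else 0)" for i j
      by (rule biorth[of "Suc (max i j)"]) (use h in auto)
    show "span (range (\<lambda>n. fst (h n))) = span (range b)"
    proof (intro equalityI span_minimal subspace_span image_subsetI)
      fix n
      have "fst (h n) \<in> span (b ` {..n})" using h[of n] by (auto simp: P_def split: prod.splits)
      then show "fst (h n) \<in> span (range b)" using span_mono[of "b ` {..n}" "range b"] by blast
      have "b n \<in> span (insert (fst (h n)) ((\<lambda>i. fst (h i)) ` {..<n}))"
        using h[of n] by (auto simp: P_def split: prod.splits)
      then show "b n \<in> span (range (\<lambda>n. fst (h n)))"
        using span_mono[of "insert (fst (h n)) ((\<lambda>i. fst (h i)) ` {..<n})" "range (\<lambda>n. fst (h n))"]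
        by blast
    qed
  qed
qed

end

subsection \<open>The operator\<close>

text \<open>The vectors \<open>w\<close> divided by \<open>a ^ n\<close> tend to 0 and are mapped
  back to \<open>w\<close> by the n-th power.\<close>

lemma expanding_mixes_to:
  fixes T :: "'a::real_normed_vector \<Rightarrow> 'a"
  assumes T: "linear T" "T w = a *\<^sub>R w" and a: "1 < a"
  shows "mixes_to T 0 w"
proof (rule mixes_to_sequence)
  have "(\<lambda>n. inverse a ^ n *\<^sub>R w) \<longlonglongrightarrow> 0 *\<^sub>R w"
    using a by (intro tendsto_intros LIMSEQ_power_zero) (simp add: field_simps)
  then show "(\<lambda>n. inverse a ^ n *\<^sub>R w) \<longlonglongrightarrow> 0" by simp
  have "(T ^^ n) w = a ^ n *\<^sub>R w" for n
    by (induction n) (simp_all add: T linear_scale[OF T(1)])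
  then have "(T ^^ n) (inverse a ^ n *\<^sub>R w) = w" for n
    using a by (simp add: linear_scale[OF linear_funpow[OF T(1)]] flip: power_mult_distrib)
  then show "(\<lambda>n. (T ^^ n) (inverse a ^ n *\<^sub>R w)) \<longlonglongrightarrow> w" by simp
qed

text \<open>The norm of \<open>S + t Q\<close> is continuous in \<open>t\<close>, below
  \<open>c\<close> at \<open>t = 0\<close> and at least \<open>c\<close> at \<open>t = c\<close>;
  the intermediate value theorem applies.\<close>

lemma exists_onorm_eq:
  fixes S Q :: "'a::real_normed_vector \<Rightarrow> 'a"
  assumes S: "bounded_linear S" and Q: "bounded_linear Q"
    and small: "onorm S < c" and large: "\<And>t. 0 < t \<Longrightarrow> t \<le> onorm (\<lambda>x. S x + t *\<^sub>R Q x)"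
  obtains t where "0 < t" "onorm (\<lambda>x. S x + t *\<^sub>R Q x) = c"
proof -
  define F where "F t = Blinfun S + t *\<^sub>R Blinfun Q" for t
  have F: "norm (F t) = onorm (\<lambda>x. S x + t *\<^sub>R Q x)" for t
    by (simp add: F_def norm_blinfun.rep_eq plus_blinfun.rep_eq scaleR_blinfun.rep_eq
        bounded_linear_Blinfun_apply S Q)
  have F0: "norm (F 0) < c" using small by (simp add: F)
  then have "0 < c" using norm_ge_zero[of "F 0"] by linarith
  have "c \<le> norm (F c)"
    using large[of c] \<open>0 < c\<close> by (simp add: F)
  moreover have "continuous_on {0..c} (\<lambda>t. norm (F t))"
    unfolding F_def by (intro continuous_intros)
  ultimately obtain t where t: "0 \<le> t" "t \<le> c" "norm (F t) = c"
    using IVT'[of "\<lambda>t. norm (F t)" 0 c c] F0 \<open>0 < c\<close> by auto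
  moreover have "t \<noteq> 0" using t(3) F0 by auto
  ultimately show thesis using that[of t] by (simp add: F)
qed

context rc_space
begin

theorem exists_J_class_operator:
  assumes reflexive: "reflexive_space sc"
    and nonseparable: "\<not> separable_space (euclidean :: 'a topology)"
    and Y: "subspace Y" "separable_space (top_of_set Y)" "\<not> (\<exists>B. finite B \<and> span B = Y)"
    and lam: "1 < lam"
  shows "\<exists>T. bounded_linear_over sc sc T \<and> J_class T \<and> Y \<subseteq> A_set T \<and> onorm T = lam"
proof -
  obtain C where C: "countable C" "C \<subseteq> Y" "Y \<subseteq> closure C"
    using Y(2) by (auto simp: separable_space_def closure_of_subtopology)
  obtain B where B: "B \<subseteq> Y" "independent B" "Y \<subseteq> span B"
    using maximal_independent_subset[of Y] by blast
  have "span B \<subseteq> Y" using B(1) Y(1) by (rule span_minimal)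
  then have "infinite B" using B(3) Y(3) by blast
  \<comment> \<open>An infinite independent part of \<open>Y\<close> is put into \<open>D\<close> so
    that \<open>Z\<close> is infinite-dimensional.\<close>
  then obtain B' where B': "B' \<subseteq> B" "countable B'" "infinite B'"
    using infinite_countable_subset' by blast
  have ind: "independent B'" using B(2) B'(1) by (rule independent_mono)
  have "B' \<noteq> {}" using B'(3) by auto
  then have D0: "countable (C \<union> B')" "C \<union> B' \<noteq> {}" using C(1) B'(2) by auto
  obtain D P where D: "countable D" "C \<union> B' \<subseteq> D" "subspace (closure D)"
    and P: "bounded_linear_over sc sc P" "\<And>x. norm (P x) \<le> norm x" "range P = closure D"
      "\<And>z. z \<in> closure D \<Longrightarrow> P z = z"
    by (rule separable_complement[OF reflexive D0]) blast
  define Z where "Z = closure D"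
  have YZ: "Y \<subseteq> Z" using C(3) closure_mono[of C D] D(2) by (auto simp: Z_def)
  \<comment> \<open>\<open>E\<close> is countable with span dense in \<open>Z\<close>, and infinite
    because the independent set \<open>B'\<close> lies in its span; it can thus be enumerated
    injectively.\<close>
  obtain E where E: "E \<subseteq> D" "independent E" "D \<subseteq> span E"
    using maximal_independent_subset[of D] by blast
  have "infinite E"
    using independent_span_bound[OF _ ind, of E] D(2) E(3) B'(3) by blast
  moreover have "countable E" using D(1) E(1) by (rule countable_subset[rotated])
  ultimately have bij: "bij_betw (from_nat_into E) UNIV E" by (simp add: bij_betw_from_nat_into)
  then have b: "independent (range (from_nat_into E))" "inj (from_nat_into E)"
    using E(2) by (simp_all add: bij_betw_def)
  \<comment> \<open>With this \<open>e\<close> the norm of \<open>I + K\<close> is at most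
    \<open>1 + e\<close>, which is below \<open>lam\<close>, so there is room to increase it to
    \<open>lam\<close>.\<close>
  define e where "e = (lam - 1) / 2"
  have e: "0 < e" using lam by (simp add: e_def)
  obtain g \<phi> where \<phi>: "\<And>n. \<phi> n \<in> dual_space sc" "\<And>i j. \<phi> i (g j) = (if i = j then 1 else 0)"
    and "span (range g) = span (range (from_nat_into E))"
    and weight: "\<And>n. onorm (\<phi> n) * norm (\<Sum>i\<in>{1..n}. (1 / fact i) *\<^sub>R g (n - i)) \<le> e / 2 ^ Suc n"
    by (rule weighted_biorthogonal_sequence[OF b e]) blast
  then have gE: "span (range g) = span E" using bij by (simp add: bij_betw_def)
  have EZ: "span E \<subseteq> Z"
    using E(1) closure_subset[of D] D(3) by (intro span_minimal) (auto simp: Z_def)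
  have Zg: "Z = closure (span (range g))"
  proof
    show "Z \<subseteq> closure (span (range g))" using E(3) by (simp add: Z_def gE closure_mono)
    show "closure (span (range g)) \<subseteq> Z" using EZ by (intro closure_minimal) (simp_all add: gE Z_def)
  qed
  have gZ: "g n \<in> Z" for n using span_base[of "g n" "range g"] EZ gE by auto
  have Pbl: "bounded_linear P" and Psc: "P (sc c x) = sc c (P x)" for c x
    using P(1) by (auto simp: bounded_linear_over_def)
  note Plin = bounded_linear.linear[OF Pbl]
  have PZ: "P x \<in> Z" for x using P(3) by (auto simp: Z_def)
  have PP: "P (P x) = P x" for x using P(4)[of "P x"] PZ by (simp add: Z_def)

  \<comment> \<open>\<open>v n\<close> is the exponential of the shift at \<open>g n\<close> without
    its identity term \<open>i = 0\<close>. The weights bound the n-th term of \<open>K x\<close> by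
    \<open>e * norm x / 2 ^ Suc n\<close>, and composing with \<open>P\<close> makes
    \<open>K\<close> vanish on the kernel of \<open>P\<close>.\<close>
  define v where "v n = (\<Sum>i\<in>{1..n}. (1 / fact i) *\<^sub>R g (n - i))" for n
  define K where "K x = (\<Sum>n. sc (\<phi> n (P x)) (v n))" for x
  have term_le: "norm (sc (\<phi> n (P x)) (v n)) \<le> e * norm x * (1 / 2) ^ Suc n" for n x
  proof -
    have "norm (\<phi> n (P x)) \<le> onorm (\<phi> n) * norm x"
      using onorm[OF dual_space_bounded_linear[OF \<phi>(1)], of n "P x"]
        mult_left_mono[OF P(2)[of x] onorm_pos_le[OF dual_space_bounded_linear[OF \<phi>(1)], of n]]
      by linarith
    then have "norm (sc (\<phi> n (P x)) (v n)) \<le> onorm (\<phi> n) * norm x * norm (v n)"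
      by (simp add: norm_scale mult_right_mono)
    also have "\<dots> = (onorm (\<phi> n) * norm (v n)) * norm x" by simp
    also have "\<dots> \<le> e / 2 ^ Suc n * norm x"
      using weight[of n] by (intro mult_right_mono) (simp_all add: v_def)
    finally show ?thesis by (simp add: power_one_over field_simps)
  qed
  have geo: "(\<lambda>n. e * norm x * (1 / 2) ^ Suc n) sums (e * norm x)" for x
    using sums_mult[OF power_half_series, of "e * norm x"] by simp
  have summable: "summable (\<lambda>n. sc (\<phi> n (P x)) (v n))" for x
    by (rule summable_comparison_test'[OF sums_summable[OF geo[of x]], of 0]) (rule term_le)
  have Knorm: "norm (K x) \<le> norm x * e" for x
    using suminf_le[of "\<lambda>n. norm (sc (\<phi> n (P x)) (v n))", OF term_le _ sums_summable[OF geo[of x]]]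
      summable_norm[of "\<lambda>n. sc (\<phi> n (P x)) (v n)"] sums_unique[OF geo[of x]]
      summable_comparison_test'[OF sums_summable[OF geo[of x]], of 0 "\<lambda>n. norm (sc (\<phi> n (P x)) (v n))"]
      term_le
    by (simp add: K_def mult.commute)
  have \<phi>lin: "linear (\<phi> n)" for n
    by (rule bounded_linear.linear[OF dual_space_bounded_linear[OF \<phi>(1)]])
  have Kadd: "K (x + y) = K x + K y" for x y
    using suminf_add[OF summable summable, of x y]
    by (simp add: K_def linear_add[OF Plin] linear_add[OF \<phi>lin] scale_left_distrib)
  have Ksc: "K (sc c x) = sc c (K x)" for c x
    using bounded_linear.suminf[OF bounded_bilinear.bounded_linear_right[OF bounded_bilinear_scale] summable, of c x]
    by (simp add: K_def Psc dual_space_scale[OF \<phi>(1)])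
  have Kbl: "bounded_linear K"
    using Ksc[of "of_real r" for r] Knorm
    by (intro bounded_linear_intro[where K = e]) (simp_all add: Kadd scale_of_real)
  have Kg: "K (g m) = v m" for m
  proof -
    have "K (g m) = (\<Sum>n\<in>{m}. sc (\<phi> n (P (g m))) (v n))"
      unfolding K_def using P(4)[of "g m"] gZ
      by (intro suminf_finite) (auto simp: \<phi>(2) Z_def)
    then show ?thesis using P(4)[of "g m"] gZ by (simp add: \<phi>(2) Z_def)
  qed
  have KW: "K w = 0" if "P w = 0" for w
    by (simp add: K_def that linear_0[OF \<phi>lin])

  \<comment> \<open>\<open>Z\<close> is separable and the whole space is not; therefore
    \<open>P\<close> has a nonzero kernel vector \<open>w0\<close>.\<close>
  have "Z \<noteq> UNIV"
    using nonseparable D(1) by (auto simp: separable_space_def Z_def)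
  then obtain x0 where x0: "x0 \<notin> Z" by blast
  define w0 where "w0 = x0 - P x0"
  have w0: "P w0 = 0" "w0 \<noteq> 0"
    using PZ[of x0] x0 by (auto simp: w0_def linear_diff[OF Plin] PP)

  have Sbl: "bounded_linear (\<lambda>x. x + K x)" and Qbl: "bounded_linear (\<lambda>x. x - P x)"
    by (intro bounded_linear_add bounded_linear_sub bounded_linear_ident Kbl Pbl)+
  have "onorm (\<lambda>x. x + K x) \<le> 1 + e"
  proof (rule onorm_bound)
    show "norm (x + K x) \<le> (1 + e) * norm x" for x
      using norm_triangle_ineq[of x "K x"] Knorm[of x] by (simp add: algebra_simps)
  qed (use e in simp)
  also have "\<dots> < lam" using lam by (simp add: e_def field_simps)
  finally have S_small: "onorm (\<lambda>x. x + K x) < lam" .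
  \<comment> \<open>The kernel vector \<open>w0\<close> is an eigenvector for the eigenvalue
    \<open>1 + t\<close>.\<close>
  have large: "t \<le> onorm (\<lambda>x. x + K x + t *\<^sub>R (x - P x))" if "0 < t" for t
  proof -
    have "(1 + t) * norm w0 = norm ((1 + t) *\<^sub>R w0)" using that by simp
    also have "(1 + t) *\<^sub>R w0 = w0 + K w0 + t *\<^sub>R (w0 - P w0)"
      by (simp add: w0 KW scaleR_add_left)
    also have "norm \<dots> \<le> onorm (\<lambda>x. x + K x + t *\<^sub>R (x - P x)) * norm w0"
      by (rule onorm) (intro bounded_linear_add Sbl bounded_linear_scaleR_right
          bounded_linear_compose[OF bounded_linear_scaleR_right Qbl])
    finally show ?thesis using w0(2) by simp
  qed
  obtain \<mu> where \<mu>: "0 < \<mu>" "onorm (\<lambda>x. x + K x + \<mu> *\<^sub>R (x - P x)) = lam"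
    by (rule exists_onorm_eq[OF Sbl Qbl S_small large]) blast+
  define T where "T x = x + K x + \<mu> *\<^sub>R (x - P x)" for x
  have Tbl: "bounded_linear T"
    unfolding T_def[abs_def]
    by (intro bounded_linear_add Sbl bounded_linear_compose[OF bounded_linear_scaleR_right Qbl])
  note Tlin = bounded_linear.linear[OF Tbl]
  have Tsc: "T (sc c x) = sc c (T x)" for c x
    by (simp add: T_def Ksc Psc scale_right_distrib scale_right_diff_distrib
        bounded_bilinear.scaleR_right[OF bounded_bilinear_scale])
  have Tg: "T (g n) = (\<Sum>i\<le>n. (1 / fact i) *\<^sub>R g (n - i))" for n
  proof -
    have "{..n} = insert 0 {1..n}" by auto
    then show ?thesis using P(4)[of "g n"] gZ by (simp add: T_def Kg v_def Z_def)
  qed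
  have Z0: "mixes_to T z 0" and Z0': "mixes_to T 0 z" if "z \<in> Z" for z
    using mixes_to_closure_span[OF Tsc Tlin, of "range g" z] mixes_to_exponential_shift[OF Tlin Tg] that
    by (auto simp: Zg)
  \<comment> \<open>The target splits as \<open>P x + (x - P x)\<close>. The three relations from
    \<open>z\<close> to 0, from 0 to \<open>P x\<close> and from 0 to the expanded part
    \<open>x - P x\<close> are added.\<close>
  have mix: "mixes_to T z x" if z: "z \<in> Z" for z x
  proof -
    have "T (x - P x) = (1 + \<mu>) *\<^sub>R (x - P x)"
      using KW[of "x - P x"] by (simp add: T_def linear_diff[OF Plin] PP scaleR_add_left)
    then have "mixes_to T 0 (x - P x)"
      using \<mu>(1) by (intro expanding_mixes_to[OF Tlin]) auto
    from mixes_to_add[OF Tlin Z0[OF z] mixes_to_add[OF Tlin Z0'[OF PZ[of x]] this]]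
    show ?thesis by simp
  qed
  have A: "Y \<subseteq> A_set T"
    using YZ mix mixes_to_J_set by (fastforce simp: A_set_def)
  \<comment> \<open>Elements of the independent set \<open>B'\<close> are nonzero vectors of
    \<open>Y\<close>, so one of them witnesses the J-class property.\<close>
  obtain y where "y \<in> B'" using \<open>B' \<noteq> {}\<close> by blast
  then have "y \<noteq> 0" "y \<in> Y" using ind B'(1) B(1) dependent_zero by blast+
  then have "J_class T" using A by (auto simp: J_class_def A_set_def)
  moreover have "onorm T = lam" using \<mu>(2) by (simp add: T_def[abs_def])
  ultimately show ?thesis
    using A Tbl Tsc by (auto simp: bounded_linear_over_def)
qed

end

theorem theorem1p19:
  assumes nonseparable: "\<not> separable_space (euclidean :: 'a::banach topology)"
  shows
    "(reflexive_space (scaleR :: real \<Rightarrow> 'a \<Rightarrow> 'a) \<longrightarrow>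
       (\<forall>Y :: 'a set. \<forall>lam :: real.
          subspace Y \<and> closed Y \<and> separable_space (top_of_set Y) \<and>
          \<not> (\<exists>B. finite B \<and> span B = Y) \<and> 1 < lam \<longrightarrow>
          (\<exists>T :: 'a \<Rightarrow> 'a. bounded_linear T \<and> J_class T \<and> Y \<subseteq> A_set T \<and> onorm T = lam)))
     \<and>
     (\<forall>sc :: complex \<Rightarrow> 'a \<Rightarrow> 'a.
       normed_space_over sc \<and> reflexive_space sc \<longrightarrow>
       (\<forall>Y :: 'a set. \<forall>lam :: real.
          module.subspace sc Y \<and> closed Y \<and> separable_space (top_of_set Y) \<and>
          \<not> (\<exists>B. finite B \<and> module.span sc B = Y) \<and> 1 < lam \<longrightarrow>
          (\<exists>T :: 'a \<Rightarrow> 'a. bounded_linear_over sc sc T \<and> J_class T \<and>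
               Y \<subseteq> A_set T \<and> onorm T = lam)))"
proof (intro conjI allI impI; elim conjE)
  fix Y :: "'a set" and lam :: real
  assume refl: "reflexive_space (scaleR :: real \<Rightarrow> 'a \<Rightarrow> 'a)"
    and Y: "subspace Y" "separable_space (top_of_set Y)" "\<not> (\<exists>B. finite B \<and> span B = Y)" "1 < lam"
  have "rc_scalars (\<lambda>x :: real. x) 0"
    by unfold_locales (auto simp: linear_iff)
  then have "rc_space (\<lambda>x :: real. x) 0 (scaleR :: real \<Rightarrow> 'a \<Rightarrow> 'a)"
    by (intro rc_space.intro normed_space_over_scaleR)
  from rc_space.exists_J_class_operator[OF this refl nonseparable, of Y lam] Y
  show "\<exists>T. bounded_linear T \<and> J_class T \<and> Y \<subseteq> A_set T \<and> onorm T = lam"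
    by (simp add: bounded_linear_over_scaleR subspace_raw_def span_raw_def)
next
  fix sc :: "complex \<Rightarrow> 'a \<Rightarrow> 'a" and Y :: "'a set" and lam :: real
  assume sc: "normed_space_over sc" "reflexive_space sc"
    and Y: "module.subspace sc Y" "separable_space (top_of_set Y)"
      "\<not> (\<exists>B. finite B \<and> module.span sc B = Y)" "1 < lam"
  have "rc_scalars Re \<i>"
    by unfold_locales (auto simp: linear_iff complex_Re_le_cmod complex_eq_iff)
  then have "rc_space Re \<i> sc"
    using sc(1) by (rule rc_space.intro)
  from rc_space.exists_J_class_operator[OF this sc(2) nonseparable Y]
  show "\<exists>T. bounded_linear_over sc sc T \<and> J_class T \<and> Y \<subseteq> A_set T \<and> onorm T = lam" .
qed

end
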